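(* Let $(\Omega,\Omega^\Omega,\mathcal B_\Omega,\mathsf P)$ be a sample space with product-compatible probability measures and assume that there is an isomorphism of quasi-measurable spaces $\Omega\cong\Omega\times\Omega$. Then the triple $(\mathsf P,\delta,\mathbb M)$ is an affine and strong monad on the quasitopos $(\mathbf{QMS},\times,\mathbf 1)$ of quasi-measurable spaces. If, furthermore, the sample space has the Fubini property, then $(\mathsf P,\delta,\mathbb M)$ is also commutative, equivalently symmetric monoidal.
   Context: Sample space: $\Omega$ is a non-empty set; $\Omega^\Omega$ is a set of maps $\Omega\to\Omega$ containing the identity and all constant maps and closed under composition; $\mathcal B_\Omega$ is a $\sigma$-algebra on $\Omega$ such that every $\Phi\in\Omega^\Omega$ is $\mathcal B_\Omega$-$\mathcal B_\Omega$-measurable. A quasi-measurable space is a pair $(\mathcal X,\mathcal X^\Omega)$ of a set and a set $\mathcal X^\Omega$ of maps $\Omega\to\mathcal X$ (admissible random variables) containing all constant maps and closed under $X\mapsto X\circ\Phi$, $\Phi\in\Omega^\Omega$. A map $g:\mathcal X\to\mathcal Y$ is quasi-measurable if $g\circ X\in\mathcal Y^\Omega$ for all $X\in\mathcal X^\Omega$. $\mathbf{QMS}$ is the resulting category; the product is $(\mathcal X\times\mathcal Y,\mathcal X^\Omega\times\mathcal Y^\Omega)$ and $\mathbf 1$ is the one-point space. $(\mathcal X^\Omega)^\Omega$ denotes the set of maps $X:\Omega\to\mathcal X^\Omega$ for which $(\omega,\omega')\mapsto X(\omega)(\omega')$ is quasi-measurable $\Omega\times\Omega\to\mathcal X$.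 The induced $\sigma$-algebra is $\mathcal B_{\mathcal X}=\{A\subseteq\mathcal X\mid X^{-1}(A)\in\mathcal B_\Omega\ \forall X\in\mathcal X^\Omega\}$; $\mathcal B_{\mathcal X\times\mathcal Y}$ is that of the product quasi-measurable space. For $D\subseteq\mathcal X\times\mathcal Y$, $D^y=\{x\mid(x,y)\in D\}$, $D_x=\{y\mid(x,y)\in D\}$. Product-compatible probability measures: $\mathsf P$ is a non-empty set of probability measures $P:\mathcal B_P\to[0,1]$ on $\Omega$, each with its own $\sigma$-algebra $\mathcal B_P$ as domain, such that: (i) for all $\Phi\in\Omega^\Omega$, $P\in\mathsf P$, $D\in\mathcal B_\Omega$: $\Phi^{-1}(D)\in\mathcal B_P$; (ii) for all $D\in\mathcal B_{\Omega\times\Omega}$ and $P\in\mathsf P$ the map $\omega\mapsto P(D^\omega)$ is $\mathcal B_\Omega$-measurable; (iii) for all $P_1,P_2\in\mathsf P$ there are $P\in\mathsf P$ and $\Phi=(\Phi_1,\Phi_2)$ with $\Phi_1,\Phi_2\in\Omega^\Omega$ such that for all $D\in\mathcal B_{\Omega\times\Omega}$: $\int P_1(D^{\omega_2})\,P_2(d\omega_2)=P(\Phi^{-1}(D))$. Fubini property: for all $P_1,P_2\in\mathsf P$ and $D\in\mathcal B_{\Omega\times\Omega}$: $\int P_2(D_{\omega_1})\,P_1(d\omega_1)=\int P_1(D^{\omega_2})\,P_2(d\omega_2)$. The quasi-measurable space $\mathsf P(\mathcal X)$: its elements are the push-forward measures $\mathcal B_{\mathcal X}\ni A\mapsto P(X^{-1}(A))$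 with $P\in\mathsf P$, $X\in\mathcal X^\Omega$; its admissible random variables are the maps $\omega\mapsto\bigl(A\mapsto P(X(\omega)^{-1}(A))\bigr)$ with $P\in\mathsf P$, $X\in(\mathcal X^\Omega)^\Omega$. Monad data: $\mathsf P$ acts on quasi-measurable maps $f$ by push-forward $\mu\mapsto f_*\mu$; the unit is $\delta_{\mathcal X}:\mathcal X\to\mathsf P(\mathcal X)$, $x\mapsto\delta_x$; the multiplication is $\mathbb M_{\mathcal X}:\mathsf P(\mathsf P(\mathcal X))\to\mathsf P(\mathcal X)$, $\mathbb M(\Pi)(A)=\int\mu(A)\,\Pi(d\mu)$. The strength is $\tau:\mathcal X\times\mathsf P(\mathcal Y)\to\mathsf P(\mathcal X\times\mathcal Y)$, $(x,\mu)\mapsto\delta_x\otimes\mu$, and the costrength is $\rho:\mathsf P(\mathcal X)\times\mathcal Y\to\mathsf P(\mathcal X\times\mathcal Y)$, $(\mu,y)\mapsto\mu\otimes\delta_y$, where $(\mu\otimes\nu)(D)=\int\mu(D^y)\,\nu(dy)$ for $D\in\mathcal B_{\mathcal X\times\mathcal Y}$. The monad is affine if $\mathsf P(\mathbf 1)\cong\mathbf 1$; strong if strength and costrength are natural, compatible with unitors, associator, unit and multiplication, and with each other; commutative if the two canonical maps $\mathsf P(\mathcal X)\times\mathsf P(\mathcal Y)\to\mathsf P(\mathcal X\times\mathcal Y)$ built from $\tau$, $\rho$ and $\mathbb M$ in the two possible orders agree. *)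

theory Defs
  imports "HOL-Probability.Probability"
begin

section \<open>Sample spaces and quasi-measurable spaces\<close>

text \<open>The sample space is the whole type \<open>'o\<close>, which is non-empty and otherwise arbitrary. Each member
  of \<open>probs\<close> is a measure with a \<open>\<sigma>\<close>-algebra of its own, namely \<open>sets P\<close>.\<close>

record 'o sample =
  endos :: "('o \<Rightarrow> 'o) set"
  events :: "'o set set"
  probs :: "'o measure set"

definition event_space :: "'o sample \<Rightarrow> 'o measure" where
  "event_space S = sigma UNIV (events S)"

definition sample_space :: "'o sample \<Rightarrow> bool" where
  "sample_space S \<longleftrightarrow>
     id \<in> endos S \<and>
     (\<forall>w. (\<lambda>_. w) \<in> endos S) \<and>
     (\<forall>\<Phi>\<in>endos S. \<forall>\<Psi>\<in>endos S. \<Phi> \<circ> \<Psi> \<in> endos S) \<and>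
     sigma_algebra UNIV (events S) \<and>
     endos S \<subseteq> event_space S \<rightarrow>\<^sub>M event_space S"

record ('o, 'x) qspace =
  pts :: "'x set"
  rvs :: "('o \<Rightarrow> 'x) set"

definition qms :: "'o sample \<Rightarrow> ('o, 'x) qspace \<Rightarrow> bool" where
  "qms S X \<longleftrightarrow>
     rvs X \<subseteq> UNIV \<rightarrow> pts X \<and>
     (\<forall>x\<in>pts X. (\<lambda>_. x) \<in> rvs X) \<and>
     (\<forall>\<alpha>\<in>rvs X. \<forall>\<Phi>\<in>endos S. \<alpha> \<circ> \<Phi> \<in> rvs X)"

text \<open>Morphisms are represented by total functions, of which only the values on the carrier of the domain
  matter. Accordingly, equations between morphisms below are stated pointwise on the carrier.\<close>

definition qm :: "('o, 'x) qspace \<Rightarrow> ('o, 'y) qspace \<Rightarrow> ('x \<Rightarrow> 'y) set" where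
  "qm X Y = {g \<in> pts X \<rightarrow> pts Y. \<forall>\<alpha>\<in>rvs X. g \<circ> \<alpha> \<in> rvs Y}"

definition qiso :: "('o, 'x) qspace \<Rightarrow> ('o, 'y) qspace \<Rightarrow> bool" where
  "qiso X Y \<longleftrightarrow> (\<exists>f\<in>qm X Y. \<exists>g\<in>qm Y X. (\<forall>x\<in>pts X. g (f x) = x) \<and> (\<forall>y\<in>pts Y. f (g y) = y))"

definition qprod :: "('o, 'x) qspace \<Rightarrow> ('o, 'y) qspace \<Rightarrow> ('o, 'x \<times> 'y) qspace"  (infixr "\<otimes>\<^sub>q" 80) where
  "X \<otimes>\<^sub>q Y = \<lparr>pts = pts X \<times> pts Y, rvs = {\<lambda>w. (\<alpha> w, \<beta> w) |\<alpha> \<beta>. \<alpha> \<in> rvs X \<and> \<beta> \<in> rvs Y}\<rparr>"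

definition qone :: "('o, unit) qspace" where
  "qone = \<lparr>pts = UNIV, rvs = UNIV\<rparr>"

definition qOmega :: "'o sample \<Rightarrow> ('o, 'o) qspace" where
  "qOmega S = \<lparr>pts = UNIV, rvs = endos S\<rparr>"

text \<open>The set \<open>(X\<^sup>\<Omega>)\<^sup>\<Omega>\<close>.\<close>

definition rvs2 :: "'o sample \<Rightarrow> ('o, 'x) qspace \<Rightarrow> ('o \<Rightarrow> 'o \<Rightarrow> 'x) set" where
  "rvs2 S X = {\<xi> \<in> UNIV \<rightarrow> rvs X. (\<lambda>(w, w'). \<xi> w w') \<in> qm (qOmega S \<otimes>\<^sub>q qOmega S) X}"

definition ind_sets :: "'o sample \<Rightarrow> ('o, 'x) qspace \<Rightarrow> 'x set set" where
  "ind_sets S X = {A. A \<subseteq> pts X \<and> (\<forall>\<alpha>\<in>rvs X. \<alpha> -` A \<in> events S)}"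

definition ind :: "'o sample \<Rightarrow> ('o, 'x) qspace \<Rightarrow> 'x measure" where
  "ind S X = sigma (pts X) (ind_sets S X)"


section \<open>Product-compatible probability measures\<close>

text \<open>The fibres are \<open>D\<^sup>y = {x. (x, y) \<in> D}\<close> and \<open>D\<^sub>x = {y. (x, y) \<in> D}\<close>. All integrands are non-negative,
  so integrals are taken with values in \<^typ>\<open>ennreal\<close>.\<close>

definition product_compatible :: "'o sample \<Rightarrow> bool" where
  "product_compatible S \<longleftrightarrow>
     probs S \<noteq> {} \<and>
     (\<forall>P\<in>probs S. prob_space P \<and> space P = UNIV) \<and>
     (\<forall>\<Phi>\<in>endos S. \<forall>P\<in>probs S. \<forall>D\<in>events S. \<Phi> -` D \<in> sets P) \<and>
     (\<forall>D\<in>ind_sets S (qOmega S \<otimes>\<^sub>q qOmega S). \<forall>P\<in>probs S.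
        (\<lambda>w. emeasure P {v. (v, w) \<in> D}) \<in> borel_measurable (event_space S)) \<and>
     (\<forall>P1\<in>probs S. \<forall>P2\<in>probs S. \<exists>P\<in>probs S. \<exists>\<Phi>1\<in>endos S. \<exists>\<Phi>2\<in>endos S.
        \<forall>D\<in>ind_sets S (qOmega S \<otimes>\<^sub>q qOmega S).
          (\<integral>\<^sup>+ w2. emeasure P1 {w1. (w1, w2) \<in> D} \<partial>P2) = emeasure P ((\<lambda>w. (\<Phi>1 w, \<Phi>2 w)) -` D))"

definition fubini_property :: "'o sample \<Rightarrow> bool" where
  "fubini_property S \<longleftrightarrow>
     (\<forall>P1\<in>probs S. \<forall>P2\<in>probs S. \<forall>D\<in>ind_sets S (qOmega S \<otimes>\<^sub>q qOmega S).
        (\<integral>\<^sup>+ w1. emeasure P2 {w2. (w1, w2) \<in> D} \<partial>P1) = (\<integral>\<^sup>+ w2. emeasure P1 {w1. (w1, w2) \<in> D} \<partial>P2))"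


section \<open>The data of the monad\<close>

definition PP :: "'o sample \<Rightarrow> ('o, 'x) qspace \<Rightarrow> ('o, 'x measure) qspace" where
  "PP S X = \<lparr>pts = {distr P (ind S X) \<alpha> |P \<alpha>. P \<in> probs S \<and> \<alpha> \<in> rvs X},
             rvs = {\<lambda>w. distr P (ind S X) (\<xi> w) |P \<xi>. P \<in> probs S \<and> \<xi> \<in> rvs2 S X}\<rparr>"

text \<open>The action on a morphism depends on its codomain \<open>Y\<close>.\<close>

definition pushf :: "'o sample \<Rightarrow> ('o, 'y) qspace \<Rightarrow> ('x \<Rightarrow> 'y) \<Rightarrow> 'x measure \<Rightarrow> 'y measure" where
  "pushf S Y f \<mu> = distr \<mu> (ind S Y) f"

definition dirac :: "'o sample \<Rightarrow> ('o, 'x) qspace \<Rightarrow> 'x \<Rightarrow> 'x measure" where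
  "dirac S X x = return (ind S X) x"

text \<open>If its last argument were not countably additive, \<^const>\<open>measure_of\<close> would return the zero measure.
  That case is excluded by the requirement, in the laws below, that the values of \<open>mult\<close>, \<open>strength\<close> and
  \<open>costrength\<close> lie in \<open>PP\<close> and hence have total mass one.\<close>

definition mult :: "'o sample \<Rightarrow> ('o, 'x) qspace \<Rightarrow> 'x measure measure \<Rightarrow> 'x measure" where
  "mult S X \<pi> = measure_of (pts X) (ind_sets S X) (\<lambda>A. \<integral>\<^sup>+ \<mu>. emeasure \<mu> A \<partial>\<pi>)"

text \<open>This is not the library's \<open>\<Otimes>\<^sub>M\<close>: the \<open>\<sigma>\<close>-algebra induced on \<open>X \<otimes>\<^sub>q Y\<close> may be larger than the product
  \<open>\<sigma>\<close>-algebra.\<close>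

definition tensor ::
  "'o sample \<Rightarrow> ('o, 'x) qspace \<Rightarrow> ('o, 'y) qspace \<Rightarrow> 'x measure \<Rightarrow> 'y measure \<Rightarrow> ('x \<times> 'y) measure" where
  "tensor S X Y \<mu> \<nu> = measure_of (pts (X \<otimes>\<^sub>q Y)) (ind_sets S (X \<otimes>\<^sub>q Y))
     (\<lambda>D. \<integral>\<^sup>+ y. emeasure \<mu> {x. (x, y) \<in> D} \<partial>\<nu>)"

definition strength ::
  "'o sample \<Rightarrow> ('o, 'x) qspace \<Rightarrow> ('o, 'y) qspace \<Rightarrow> 'x \<times> 'y measure \<Rightarrow> ('x \<times> 'y) measure" where
  "strength S X Y = (\<lambda>(x, \<nu>). tensor S X Y (dirac S X x) \<nu>)"

definition costrength ::
  "'o sample \<Rightarrow> ('o, 'x) qspace \<Rightarrow> ('o, 'y) qspace \<Rightarrow> 'x measure \<times> 'y \<Rightarrow> ('x \<times> 'y) measure" where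
  "costrength S X Y = (\<lambda>(\<mu>, y). tensor S X Y \<mu> (dirac S Y y))"

text \<open>The two canonical maps \<open>PP X \<times> PP Y \<rightarrow> PP (X \<times> Y)\<close>: the first goes through \<open>PP (PP X \<times> Y)\<close>, the
  second through \<open>PP (X \<times> PP Y)\<close>.\<close>

definition dstrength ::
  "'o sample \<Rightarrow> ('o, 'x) qspace \<Rightarrow> ('o, 'y) qspace \<Rightarrow> 'x measure \<times> 'y measure \<Rightarrow> ('x \<times> 'y) measure" where
  "dstrength S X Y = mult S (X \<otimes>\<^sub>q Y) \<circ> pushf S (PP S (X \<otimes>\<^sub>q Y)) (costrength S X Y) \<circ> strength S (PP S X) Y"

definition dstrength' ::
  "'o sample \<Rightarrow> ('o, 'x) qspace \<Rightarrow> ('o, 'y) qspace \<Rightarrow> 'x measure \<times> 'y measure \<Rightarrow> ('x \<times> 'y) measure" where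
  "dstrength' S X Y = mult S (X \<otimes>\<^sub>q Y) \<circ> pushf S (PP S (X \<otimes>\<^sub>q Y)) (strength S X Y) \<circ> costrength S X (PP S Y)"

definition assoc :: "('x \<times> 'y) \<times> 'z \<Rightarrow> 'x \<times> 'y \<times> 'z" where
  "assoc = (\<lambda>((x, y), z). (x, (y, z)))"


section \<open>Laws\<close>

text \<open>Objects of the category live on arbitrary types, over which HOL cannot quantify inside a formula. The
  predicates below take the types of the objects as arguments and quantify over all objects and
  morphisms on these types; a statement with free type variables then covers all types.\<close>

definition monad_on_QMS :: "'o sample \<Rightarrow> 'x itself \<Rightarrow> 'y itself \<Rightarrow> 'z itself \<Rightarrow> bool" where
  "monad_on_QMS S tx ty tz \<longleftrightarrow>
     (\<forall>X :: ('o, 'x) qspace. qms S X \<longrightarrow> qms S (PP S X)) \<and>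
     (\<forall>(X :: ('o, 'x) qspace) (Y :: ('o, 'y) qspace). qms S X \<longrightarrow> qms S Y \<longrightarrow>
        (\<forall>f\<in>qm X Y. pushf S Y f \<in> qm (PP S X) (PP S Y))) \<and>
     (\<forall>X :: ('o, 'x) qspace. qms S X \<longrightarrow> (\<forall>\<mu>\<in>pts (PP S X). pushf S X id \<mu> = \<mu>)) \<and>
     (\<forall>(X :: ('o, 'x) qspace) (Y :: ('o, 'y) qspace) (Z :: ('o, 'z) qspace).
        qms S X \<longrightarrow> qms S Y \<longrightarrow> qms S Z \<longrightarrow>
        (\<forall>f\<in>qm X Y. \<forall>g\<in>qm Y Z. \<forall>\<mu>\<in>pts (PP S X). pushf S Z (g \<circ> f) \<mu> = pushf S Z g (pushf S Y f \<mu>))) \<and>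
     (\<forall>X :: ('o, 'x) qspace. qms S X \<longrightarrow>
        dirac S X \<in> qm X (PP S X) \<and> mult S X \<in> qm (PP S (PP S X)) (PP S X)) \<and>
     (\<forall>(X :: ('o, 'x) qspace) (Y :: ('o, 'y) qspace). qms S X \<longrightarrow> qms S Y \<longrightarrow>
        (\<forall>f\<in>qm X Y.
           (\<forall>x\<in>pts X. pushf S Y f (dirac S X x) = dirac S Y (f x)) \<and>
           (\<forall>\<pi>\<in>pts (PP S (PP S X)).
              pushf S Y f (mult S X \<pi>) = mult S Y (pushf S (PP S Y) (pushf S Y f) \<pi>)))) \<and>
     (\<forall>X :: ('o, 'x) qspace. qms S X \<longrightarrow>
        (\<forall>\<mu>\<in>pts (PP S X).
           mult S X (dirac S (PP S X) \<mu>) = \<mu> \<and> mult S X (pushf S (PP S X) (dirac S X) \<mu>) = \<mu>) \<and>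
        (\<forall>\<theta>\<in>pts (PP S (PP S (PP S X))).
           mult S X (mult S (PP S X) \<theta>) = mult S X (pushf S (PP S X) (mult S X) \<theta>)))"

definition affine_monad :: "'o sample \<Rightarrow> bool" where
  "affine_monad S \<longleftrightarrow> qiso (PP S (qone :: ('o, unit) qspace)) (qone :: ('o, unit) qspace)"

text \<open>The conjuncts are: \<open>strength\<close> and \<open>costrength\<close> are morphisms, are natural in both arguments, and are
  compatible with the unitors, the associator, unit and multiplication. That they are compatible with each
  other is the third equation for the associator, and the last conjunct: each is obtained from the other by
  the braiding of \<open>\<otimes>\<^sub>q\<close>.\<close>

definition strong_monad :: "'o sample \<Rightarrow> 'x itself \<Rightarrow> 'y itself \<Rightarrow> 'z itself \<Rightarrow> 'w itself \<Rightarrow> bool" where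
  "strong_monad S tx ty tz tw \<longleftrightarrow>
     (\<forall>(X :: ('o, 'x) qspace) (Y :: ('o, 'y) qspace). qms S X \<longrightarrow> qms S Y \<longrightarrow>
        strength S X Y \<in> qm (X \<otimes>\<^sub>q PP S Y) (PP S (X \<otimes>\<^sub>q Y)) \<and>
        costrength S X Y \<in> qm (PP S X \<otimes>\<^sub>q Y) (PP S (X \<otimes>\<^sub>q Y))) \<and>
     (\<forall>(X :: ('o, 'x) qspace) (Y :: ('o, 'y) qspace) (Z :: ('o, 'z) qspace) (W :: ('o, 'w) qspace).
        qms S X \<longrightarrow> qms S Y \<longrightarrow> qms S Z \<longrightarrow> qms S W \<longrightarrow>
        (\<forall>f\<in>qm X Z. \<forall>g\<in>qm Y W.
           (\<forall>x\<in>pts X. \<forall>\<nu>\<in>pts (PP S Y).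
              pushf S (Z \<otimes>\<^sub>q W) (map_prod f g) (strength S X Y (x, \<nu>)) = strength S Z W (f x, pushf S W g \<nu>)) \<and>
           (\<forall>\<mu>\<in>pts (PP S X). \<forall>y\<in>pts Y.
              pushf S (Z \<otimes>\<^sub>q W) (map_prod f g) (costrength S X Y (\<mu>, y))
                = costrength S Z W (pushf S Z f \<mu>, g y)))) \<and>
     (\<forall>X :: ('o, 'x) qspace. qms S X \<longrightarrow>
        (\<forall>\<mu>\<in>pts (PP S X).
           pushf S X snd (strength S qone X ((), \<mu>)) = \<mu> \<and>
           pushf S X fst (costrength S X qone (\<mu>, ())) = \<mu>)) \<and>
     (\<forall>(X :: ('o, 'x) qspace) (Y :: ('o, 'y) qspace) (Z :: ('o, 'z) qspace).
        qms S X \<longrightarrow> qms S Y \<longrightarrow> qms S Z \<longrightarrow>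
        (\<forall>x\<in>pts X. \<forall>y\<in>pts Y. \<forall>\<kappa>\<in>pts (PP S Z).
           pushf S (X \<otimes>\<^sub>q Y \<otimes>\<^sub>q Z) assoc (strength S (X \<otimes>\<^sub>q Y) Z ((x, y), \<kappa>))
             = strength S X (Y \<otimes>\<^sub>q Z) (x, strength S Y Z (y, \<kappa>))) \<and>
        (\<forall>\<mu>\<in>pts (PP S X). \<forall>y\<in>pts Y. \<forall>z\<in>pts Z.
           pushf S (X \<otimes>\<^sub>q Y \<otimes>\<^sub>q Z) assoc (costrength S (X \<otimes>\<^sub>q Y) Z (costrength S X Y (\<mu>, y), z))
             = costrength S X (Y \<otimes>\<^sub>q Z) (\<mu>, (y, z))) \<and>
        (\<forall>x\<in>pts X. \<forall>\<nu>\<in>pts (PP S Y). \<forall>z\<in>pts Z.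
           pushf S (X \<otimes>\<^sub>q Y \<otimes>\<^sub>q Z) assoc (costrength S (X \<otimes>\<^sub>q Y) Z (strength S X Y (x, \<nu>), z))
             = strength S X (Y \<otimes>\<^sub>q Z) (x, costrength S Y Z (\<nu>, z)))) \<and>
     (\<forall>(X :: ('o, 'x) qspace) (Y :: ('o, 'y) qspace). qms S X \<longrightarrow> qms S Y \<longrightarrow>
        (\<forall>x\<in>pts X. \<forall>y\<in>pts Y.
           strength S X Y (x, dirac S Y y) = dirac S (X \<otimes>\<^sub>q Y) (x, y) \<and>
           costrength S X Y (dirac S X x, y) = dirac S (X \<otimes>\<^sub>q Y) (x, y)) \<and>
        (\<forall>x\<in>pts X. \<forall>\<pi>\<in>pts (PP S (PP S Y)).
           strength S X Y (x, mult S Y \<pi>)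
             = mult S (X \<otimes>\<^sub>q Y) (pushf S (PP S (X \<otimes>\<^sub>q Y)) (strength S X Y) (strength S X (PP S Y) (x, \<pi>)))) \<and>
        (\<forall>\<pi>\<in>pts (PP S (PP S X)). \<forall>y\<in>pts Y.
           costrength S X Y (mult S X \<pi>, y)
             = mult S (X \<otimes>\<^sub>q Y) (pushf S (PP S (X \<otimes>\<^sub>q Y)) (costrength S X Y) (costrength S (PP S X) Y (\<pi>, y)))) \<and>
        (\<forall>\<mu>\<in>pts (PP S X). \<forall>y\<in>pts Y.
           costrength S X Y (\<mu>, y) = pushf S (X \<otimes>\<^sub>q Y) prod.swap (strength S Y X (y, \<mu>))))"

definition commutative_monad :: "'o sample \<Rightarrow> 'x itself \<Rightarrow> 'y itself \<Rightarrow> bool" where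
  "commutative_monad S tx ty \<longleftrightarrow>
     (\<forall>(X :: ('o, 'x) qspace) (Y :: ('o, 'y) qspace). qms S X \<longrightarrow> qms S Y \<longrightarrow>
        (\<forall>p\<in>pts (PP S X \<otimes>\<^sub>q PP S Y). dstrength S X Y p = dstrength' S X Y p))"

text \<open>The functor is lax symmetric monoidal, with \<open>dirac\<close> at \<open>qone\<close> and \<open>dstrength\<close> as its structure maps, and
  unit and multiplication are monoidal transformations. The compatibility of \<open>dirac\<close> with the nullary
  structure map holds by the choice of the latter.\<close>

definition symmetric_monoidal_monad ::
  "'o sample \<Rightarrow> 'x itself \<Rightarrow> 'y itself \<Rightarrow> 'z itself \<Rightarrow> 'w itself \<Rightarrow> bool" where
  "symmetric_monoidal_monad S tx ty tz tw \<longleftrightarrow>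
     dirac S qone \<in> qm qone (PP S (qone :: ('o, unit) qspace)) \<and>
     (\<forall>(X :: ('o, 'x) qspace) (Y :: ('o, 'y) qspace). qms S X \<longrightarrow> qms S Y \<longrightarrow>
        dstrength S X Y \<in> qm (PP S X \<otimes>\<^sub>q PP S Y) (PP S (X \<otimes>\<^sub>q Y))) \<and>
     (\<forall>(X :: ('o, 'x) qspace) (Y :: ('o, 'y) qspace) (Z :: ('o, 'z) qspace) (W :: ('o, 'w) qspace).
        qms S X \<longrightarrow> qms S Y \<longrightarrow> qms S Z \<longrightarrow> qms S W \<longrightarrow>
        (\<forall>f\<in>qm X Z. \<forall>g\<in>qm Y W. \<forall>\<mu>\<in>pts (PP S X). \<forall>\<nu>\<in>pts (PP S Y).
           pushf S (Z \<otimes>\<^sub>q W) (map_prod f g) (dstrength S X Y (\<mu>, \<nu>))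
             = dstrength S Z W (pushf S Z f \<mu>, pushf S W g \<nu>))) \<and>
     (\<forall>(X :: ('o, 'x) qspace) (Y :: ('o, 'y) qspace) (Z :: ('o, 'z) qspace).
        qms S X \<longrightarrow> qms S Y \<longrightarrow> qms S Z \<longrightarrow>
        (\<forall>\<mu>\<in>pts (PP S X). \<forall>\<nu>\<in>pts (PP S Y). \<forall>\<kappa>\<in>pts (PP S Z).
           pushf S (X \<otimes>\<^sub>q Y \<otimes>\<^sub>q Z) assoc (dstrength S (X \<otimes>\<^sub>q Y) Z (dstrength S X Y (\<mu>, \<nu>), \<kappa>))
             = dstrength S X (Y \<otimes>\<^sub>q Z) (\<mu>, dstrength S Y Z (\<nu>, \<kappa>)))) \<and>
     (\<forall>X :: ('o, 'x) qspace. qms S X \<longrightarrow>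
        (\<forall>\<mu>\<in>pts (PP S X).
           pushf S X snd (dstrength S qone X (dirac S qone (), \<mu>)) = \<mu> \<and>
           pushf S X fst (dstrength S X qone (\<mu>, dirac S qone ())) = \<mu>)) \<and>
     (\<forall>(X :: ('o, 'x) qspace) (Y :: ('o, 'y) qspace). qms S X \<longrightarrow> qms S Y \<longrightarrow>
        (\<forall>\<mu>\<in>pts (PP S X). \<forall>\<nu>\<in>pts (PP S Y).
           pushf S (Y \<otimes>\<^sub>q X) prod.swap (dstrength S X Y (\<mu>, \<nu>)) = dstrength S Y X (\<nu>, \<mu>)) \<and>
        (\<forall>x\<in>pts X. \<forall>y\<in>pts Y. dstrength S X Y (dirac S X x, dirac S Y y) = dirac S (X \<otimes>\<^sub>q Y) (x, y)) \<and>
        (\<forall>\<pi>\<in>pts (PP S (PP S X)). \<forall>\<sigma>\<in>pts (PP S (PP S Y)).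
           dstrength S X Y (mult S X \<pi>, mult S Y \<sigma>)
             = mult S (X \<otimes>\<^sub>q Y)
                 (pushf S (PP S (X \<otimes>\<^sub>q Y)) (dstrength S X Y) (dstrength S (PP S X) (PP S Y) (\<pi>, \<sigma>))))) \<and>
     mult S (qone :: ('o, unit) qspace) (pushf S (PP S qone) (dirac S qone) (dirac S qone ()))
       = dirac S qone ()"


section \<open>Consistency checks\<close>

lemma sigma_algebra_ind_sets:
  assumes "sample_space S" "qms S X"
  shows "sigma_algebra (pts X) (ind_sets S X)"
  unfolding sigma_algebra_iff2
proof (intro conjI ballI allI impI)
  interpret E: sigma_algebra UNIV "events S"
    using assms(1) by (simp add: sample_space_def)
  show "ind_sets S X \<subseteq> Pow (pts X)" "{} \<in> ind_sets S X"
    by (auto simp: ind_sets_def)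
  show "pts X - A \<in> ind_sets S X" if A: "A \<in> ind_sets S X" for A
  proof -
    have "\<alpha> -` (pts X - A) \<in> events S" if "\<alpha> \<in> rvs X" for \<alpha>
    proof -
      have "range \<alpha> \<subseteq> pts X"
        using assms(2) that by (auto simp: qms_def)
      then have "\<alpha> -` (pts X - A) = UNIV - \<alpha> -` A"
        by blast
      moreover have "\<alpha> -` A \<in> events S"
        using A that by (simp add: ind_sets_def)
      ultimately show ?thesis
        using E.compl_sets by simp
    qed
    then show ?thesis
      by (simp add: ind_sets_def)
  qed
  show "(\<Union>i. A i) \<in> ind_sets S X" if A: "range A \<subseteq> ind_sets S X" for A :: "nat \<Rightarrow> _"
  proof -
    have "(\<Union>i. \<alpha> -` A i) \<in> events S" if "\<alpha> \<in> rvs X" for \<alpha>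
    proof (rule E.countable_nat_UN)
      show "range (\<lambda>i. \<alpha> -` A i) \<subseteq> events S"
        using A that unfolding ind_sets_def by blast
    qed
    moreover have "(\<Union>i. A i) \<subseteq> pts X"
      using A unfolding ind_sets_def by blast
    ultimately show ?thesis
      by (simp add: ind_sets_def vimage_UN)
  qed
qed

text \<open>Hence passing to the generated \<open>\<sigma>\<close>-algebra in \<^const>\<open>ind\<close> adds no sets.\<close>

lemma sets_ind: "sample_space S \<Longrightarrow> qms S X \<Longrightarrow> sets (ind S X) = ind_sets S X"
  unfolding ind_def by (rule sigma_algebra.sets_measure_of_eq[OF sigma_algebra_ind_sets])

lemma qms_qOmega: "sample_space S \<Longrightarrow> qms S (qOmega S)"
  by (simp add: sample_space_def qms_def qOmega_def)

lemma qms_qone: "qms S qone"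
  by (simp add: qms_def qone_def)

lemma rvs_qprodI: "\<alpha> \<in> rvs X \<Longrightarrow> \<beta> \<in> rvs Y \<Longrightarrow> (\<lambda>w. (\<alpha> w, \<beta> w)) \<in> rvs (X \<otimes>\<^sub>q Y)"
  unfolding qprod_def qspace.select_convs by blast

lemma qms_qprod:
  assumes "qms S X" "qms S Y"
  shows "qms S (X \<otimes>\<^sub>q Y)"
  unfolding qms_def
proof (intro conjI ballI)
  show "rvs (X \<otimes>\<^sub>q Y) \<subseteq> UNIV \<rightarrow> pts (X \<otimes>\<^sub>q Y)"
    using assms by (auto simp: qms_def qprod_def)
  show "(\<lambda>_. p) \<in> rvs (X \<otimes>\<^sub>q Y)" if "p \<in> pts (X \<otimes>\<^sub>q Y)" for p
  proof -
    have "(\<lambda>_. fst p) \<in> rvs X" "(\<lambda>_. snd p) \<in> rvs Y"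
      using assms that by (simp_all add: qms_def qprod_def mem_Times_iff)
    from rvs_qprodI[OF this] show ?thesis
      by simp
  qed
  show "\<gamma> \<circ> \<Phi> \<in> rvs (X \<otimes>\<^sub>q Y)" if "\<gamma> \<in> rvs (X \<otimes>\<^sub>q Y)" "\<Phi> \<in> endos S" for \<gamma> \<Phi>
  proof -
    from that obtain \<alpha> \<beta> where *: "\<alpha> \<in> rvs X" "\<beta> \<in> rvs Y" "\<gamma> = (\<lambda>w. (\<alpha> w, \<beta> w))"
      unfolding qprod_def qspace.select_convs by blast
    then have "\<alpha> \<circ> \<Phi> \<in> rvs X" "\<beta> \<circ> \<Phi> \<in> rvs Y"
      using assms that by (simp_all add: qms_def)
    from rvs_qprodI[OF this] show ?thesis
      by (simp add: * comp_def)
  qed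
qed

lemma ind_sets_qOmega:
  assumes "sample_space S"
  shows "ind_sets S (qOmega S) = events S"
proof -
  interpret E: sigma_algebra UNIV "events S"
    using assms by (simp add: sample_space_def)
  have "\<Phi> -` D \<in> events S" if "\<Phi> \<in> endos S" "D \<in> events S" for \<Phi> D
  proof -
    have "\<Phi> \<in> event_space S \<rightarrow>\<^sub>M event_space S"
      using assms that unfolding sample_space_def by blast
    from measurable_sets[OF this, of D] that show ?thesis
      by (simp add: event_space_def)
  qed
  moreover have "D \<in> events S" if "\<forall>\<Phi>\<in>endos S. \<Phi> -` D \<in> events S" for D
  proof -
    have "id -` D \<in> events S"
      using assms that unfolding sample_space_def by blast
    then show ?thesis
      by simp
  qed
  ultimately show ?thesis
    unfolding ind_sets_def qOmega_def qspace.select_convs by blast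
qed

end

theory Submission
  imports Defs
begin

text \<open>By condition (ii), evaluation at a set is measurable on \<open>PP X\<close>, so every morphism \<open>Z \<rightarrow> PP X\<close> is a
  probability kernel and the Giry calculus of \<open>\<bind>\<close> applies: \<open>mult\<close> is \<open>\<bind>\<close> with the identity and \<open>tensor \<mu> \<nu>\<close>
  is \<open>\<nu> \<bind> (\<lambda>y. \<mu> \<otimes> \<delta>\<^sub>y)\<close>, whence all the equations. What remains is that the values are again
  push-forwards of members of \<open>probs\<close>, depending admissibly on parameters. This is condition (iii), which writes
  an iterated integral as a single push-forward. The two double strengths are the two orders of integration.\<close>

section \<open>Quasi-measurable maps\<close>

text \<open>The induced \<sigma>-algebras are not the standard ones: that of
  \<open>X \<otimes>\<^sub>q Y\<close> may exceed the product \<sigma>-algebra, and that of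
  \<open>PP S X\<close> is not defined through evaluations, so product measures and the classical
  exchange theorem do not apply. What helps is that \<open>ind S X\<close> is the largest
  \<sigma>-algebra making all random variables measurable: a map out of it is measurable once its
  composites with random variables are. Evaluations pass this test, and so the identity on
  \<open>PP S X\<close> is a kernel into \<open>subprob_algebra (ind S X)\<close>. The second
  obstacle is uniformity. An admissible random variable of \<open>PP S X\<close> uses one
  probability for all parameters, so representing each value separately is not enough. A random
  variable of \<open>PP S (PP S X)\<close> yields at each parameter a random variable of
  \<open>PP S X\<close>, whose probability could vary with the parameter; this is why \<Omega> has
  to absorb \<Omega> \<times> \<Omega>. For \<open>tensor\<close>, both factors bring a probability
  that is already fixed, and condition (iii) applies to these two directly.\<close>

lemma space_ind [simp]: "space (ind S X) = pts X"
  unfolding ind_def by (rule space_measure_of) (auto simp: ind_sets_def)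

lemma space_event_space [simp]: "space (event_space S) = UNIV"
  by (simp add: event_space_def space_measure_of_conv)

lemma pts_qprod [simp]: "pts (X \<otimes>\<^sub>q Y) = pts X \<times> pts Y"
  by (simp add: qprod_def)

lemma pts_qOmega [simp]: "pts (qOmega S) = UNIV"
  and rvs_qOmega [simp]: "rvs (qOmega S) = endos S"
  by (simp_all add: qOmega_def)

lemma qprod_rvE:
  assumes "\<gamma> \<in> rvs (X \<otimes>\<^sub>q Y)"
  obtains \<alpha> \<beta> where "\<alpha> \<in> rvs X" "\<beta> \<in> rvs Y" "\<gamma> = (\<lambda>w. (\<alpha> w, \<beta> w))"
  using assms by (auto simp: qprod_def)

lemma rvs_qprod_iff:
  "\<gamma> \<in> rvs (X \<otimes>\<^sub>q Y) \<longleftrightarrow> (\<lambda>w. fst (\<gamma> w)) \<in> rvs X \<and> (\<lambda>w. snd (\<gamma> w)) \<in> rvs Y"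
  using rvs_qprodI[of "\<lambda>w. fst (\<gamma> w)" X "\<lambda>w. snd (\<gamma> w)" Y] by (auto elim: qprod_rvE)

lemma PP_ptE:
  assumes "\<mu> \<in> pts (PP S X)"
  obtains P \<alpha> where "P \<in> probs S" "\<alpha> \<in> rvs X" "\<mu> = distr P (ind S X) \<alpha>"
  using assms by (auto simp: PP_def)

lemma PP_rvE:
  assumes "\<gamma> \<in> rvs (PP S X)"
  obtains P \<xi> where "P \<in> probs S" "\<xi> \<in> rvs2 S X" "\<gamma> = (\<lambda>w. distr P (ind S X) (\<xi> w))"
  using assms by (auto simp: PP_def)

lemma PP_rvI: "P \<in> probs S \<Longrightarrow> \<xi> \<in> rvs2 S X \<Longrightarrow> (\<lambda>w. distr P (ind S X) (\<xi> w)) \<in> rvs (PP S X)"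
  by (auto simp: PP_def)

lemma qms_rv_pts: "qms S X \<Longrightarrow> \<alpha> \<in> rvs X \<Longrightarrow> \<alpha> w \<in> pts X"
  by (auto simp: qms_def)

lemma qms_rv_comp: "qms S X \<Longrightarrow> \<alpha> \<in> rvs X \<Longrightarrow> \<Phi> \<in> endos S \<Longrightarrow> (\<lambda>w. \<alpha> (\<Phi> w)) \<in> rvs X"
  by (auto simp: qms_def comp_def)

lemma qms_rv_const: "qms S X \<Longrightarrow> x \<in> pts X \<Longrightarrow> (\<lambda>_. x) \<in> rvs X"
  by (auto simp: qms_def)

lemma qm_pts: "f \<in> qm X Y \<Longrightarrow> x \<in> pts X \<Longrightarrow> f x \<in> pts Y"
  by (auto simp: qm_def)

lemma qm_rv: "f \<in> qm X Y \<Longrightarrow> \<alpha> \<in> rvs X \<Longrightarrow> (\<lambda>w. f (\<alpha> w)) \<in> rvs Y"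
  by (auto simp: qm_def comp_def)

text \<open>Constant random variables take care of the carrier.\<close>

lemma qmI:
  assumes "qms S X" "qms S Y" "\<And>\<alpha>. \<alpha> \<in> rvs X \<Longrightarrow> (\<lambda>w. f (\<alpha> w)) \<in> rvs Y"
  shows "f \<in> qm X Y"
  using assms(3) qms_rv_pts[OF assms(2) assms(3)[OF qms_rv_const[OF assms(1)]]]
  by (auto simp: qm_def comp_def)

lemma qm_comp: "f \<in> qm X Y \<Longrightarrow> g \<in> qm Y Z \<Longrightarrow> (\<lambda>x. g (f x)) \<in> qm X Z"
  by (auto simp: qm_def comp_def)

lemma qm_Pair_left: "qms S X \<Longrightarrow> qms S Y \<Longrightarrow> x \<in> pts X \<Longrightarrow> Pair x \<in> qm Y (X \<otimes>\<^sub>q Y)"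
  by (rule qmI[where S=S]) (auto intro: qms_qprod rvs_qprodI qms_rv_const)

lemma qm_Pair_right: "qms S X \<Longrightarrow> qms S Y \<Longrightarrow> y \<in> pts Y \<Longrightarrow> (\<lambda>x. (x, y)) \<in> qm X (X \<otimes>\<^sub>q Y)"
  by (rule qmI[where S=S]) (auto intro: qms_qprod rvs_qprodI qms_rv_const)

lemma qm_fst: "qms S X \<Longrightarrow> qms S Y \<Longrightarrow> fst \<in> qm (X \<otimes>\<^sub>q Y) X"
  by (rule qmI[where S=S]) (auto simp: rvs_qprod_iff intro: qms_qprod)

lemma qm_snd: "qms S X \<Longrightarrow> qms S Y \<Longrightarrow> snd \<in> qm (X \<otimes>\<^sub>q Y) Y"
  by (rule qmI[where S=S]) (auto simp: rvs_qprod_iff intro: qms_qprod)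

lemma qm_swap: "qms S X \<Longrightarrow> qms S Y \<Longrightarrow> prod.swap \<in> qm (X \<otimes>\<^sub>q Y) (Y \<otimes>\<^sub>q X)"
  by (rule qmI[where S=S]) (auto simp: rvs_qprod_iff intro: qms_qprod)

lemma qm_map_prod:
  "qms S X \<Longrightarrow> qms S Y \<Longrightarrow> qms S Z \<Longrightarrow> qms S W \<Longrightarrow> f \<in> qm X Z \<Longrightarrow> g \<in> qm Y W \<Longrightarrow>
    map_prod f g \<in> qm (X \<otimes>\<^sub>q Y) (Z \<otimes>\<^sub>q W)"
  by (rule qmI[where S=S]) (auto simp: rvs_qprod_iff intro: qms_qprod qm_rv)

lemma qm_assoc:
  "qms S X \<Longrightarrow> qms S Y \<Longrightarrow> qms S Z \<Longrightarrow> assoc \<in> qm ((X \<otimes>\<^sub>q Y) \<otimes>\<^sub>q Z) (X \<otimes>\<^sub>q Y \<otimes>\<^sub>q Z)"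
  by (rule qmI[where S=S])
    (auto simp: assoc_def rvs_qprod_iff case_prod_beta intro: qms_qprod)

lemma assoc_apply [simp]: "assoc ((x, y), z) = (x, y, z)"
  by (simp add: assoc_def)

text \<open>Bridge from \<open>mult\<close> and \<open>tensor\<close>, which are given by set
  functions, to measures built with \<open>bind\<close>. Countable additivity of \<open>F\<close> is
  inherited from \<open>M\<close> and never has to be checked by itself.\<close>

lemma measure_of_ind_eq:
  assumes "sample_space S" "qms S X" "sets M = sets (ind S X)"
    and "\<And>A. A \<in> sets (ind S X) \<Longrightarrow> F A = emeasure M A"
  shows "measure_of (pts X) (ind_sets S X) F = M"
proof -
  interpret sigma_algebra "pts X" "ind_sets S X"
    by (rule sigma_algebra_ind_sets[OF assms(1,2)])
  have "measure_of (pts X) (ind_sets S X) F = measure_of (space M) (sets M) (emeasure M)"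
    unfolding assms(3) sets_eq_imp_space_eq[OF assms(3)] space_ind sets_ind[OF assms(1,2)]
    using assms(4) by (intro measure_of_eq space_closed) (simp add: sigma_sets_eq sets_ind[OF assms(1,2)])
  then show ?thesis
    by (simp add: measure_of_of_measure)
qed

text \<open>The isomorphism of \<Omega> with its square stays outside the locale: it is an explicit
  assumption of the lemmas that rely on multiplication being a morphism.\<close>

locale compatible_sample =
  fixes S :: "'o sample"
  assumes sample_space: "sample_space S"
    and product_compatible: "product_compatible S"
begin

lemma id_endo: "(\<lambda>w. w) \<in> endos S"
  using sample_space by (simp add: sample_space_def id_def)

lemma const_endo: "(\<lambda>_. w) \<in> endos S"
  using sample_space by (simp add: sample_space_def)

lemmas qms_Omega = qms_qOmega[OF sample_space]
text \<open>Endomorphisms are the random variables of \<open>qOmega S\<close>, so closure under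
  composition is an instance of \<open>qms_rv_comp\<close>.\<close>

lemmas endo_comp = qms_rv_comp[OF qms_Omega, simplified]

lemma sets_event_space: "sets (event_space S) = events S"
proof -
  interpret sigma_algebra UNIV "events S"
    using sample_space by (simp add: sample_space_def)
  show ?thesis
    by (simp add: event_space_def)
qed

section \<open>Probabilities and measurability over the sample space\<close>

lemma probs_nonempty: "probs S \<noteq> {}"
  using product_compatible by (simp add: product_compatible_def)

lemma prob_space_probs: "P \<in> probs S \<Longrightarrow> prob_space P"
  using product_compatible by (simp add: product_compatible_def)

lemma space_probs: "P \<in> probs S \<Longrightarrow> space P = UNIV"
  using product_compatible by (simp add: product_compatible_def)

text \<open>Condition (i) at the identity. Since \<open>sets P\<close> may be larger than
  \<open>events S\<close>, this inclusion is what carries measurability over to the members of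
  \<open>probs S\<close>.\<close>

lemma events_subset_sets: "P \<in> probs S \<Longrightarrow> events S \<subseteq> sets P"
  using product_compatible id_endo unfolding product_compatible_def by fastforce

lemma measurable_probs:
  assumes "P \<in> probs S" "f \<in> event_space S \<rightarrow>\<^sub>M N"
  shows "f \<in> P \<rightarrow>\<^sub>M N"
  using assms events_subset_sets[OF assms(1)] space_probs[OF assms(1)]
  by (auto simp: measurable_def sets_event_space)

lemma measurable_rv:
  assumes "qms S X" "\<alpha> \<in> rvs X"
  shows "\<alpha> \<in> event_space S \<rightarrow>\<^sub>M ind S X"
  using assms by (auto simp: measurable_def sets_ind[OF sample_space] sets_event_space ind_sets_def
      intro: qms_rv_pts)

lemma measurable_probs_rv: "P \<in> probs S \<Longrightarrow> qms S X \<Longrightarrow> \<alpha> \<in> rvs X \<Longrightarrow> \<alpha> \<in> P \<rightarrow>\<^sub>M ind S X"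
  by (blast intro: measurable_probs measurable_rv)

text \<open>The induced \<sigma>-algebra is final for the random variables. Constant random
  variables ensure that \<open>f\<close> maps the carrier into \<open>space N\<close>.\<close>

lemma measurable_indI:
  assumes "qms S X" "\<And>\<alpha>. \<alpha> \<in> rvs X \<Longrightarrow> (\<lambda>w. f (\<alpha> w)) \<in> event_space S \<rightarrow>\<^sub>M N"
  shows "f \<in> ind S X \<rightarrow>\<^sub>M N"
proof (rule measurableI)
  show "f x \<in> space N" if "x \<in> space (ind S X)" for x
    using assms(2)[OF qms_rv_const[OF assms(1)]] that by (auto simp: measurable_def)
  show "f -` A \<inter> space (ind S X) \<in> sets (ind S X)" if "A \<in> sets N" for A
  proof -
    have "\<alpha> -` (f -` A \<inter> pts X) \<in> events S" if "\<alpha> \<in> rvs X" for \<alpha>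
    proof -
      have "\<alpha> -` (f -` A \<inter> pts X) = (\<lambda>w. f (\<alpha> w)) -` A \<inter> space (event_space S)"
        using qms_rv_pts[OF assms(1) that] by auto
      then show ?thesis
        using measurable_sets[OF assms(2)[OF that] \<open>A \<in> sets N\<close>] by (simp add: sets_event_space)
    qed
    then show ?thesis
      by (auto simp: sets_ind[OF sample_space assms(1)] ind_sets_def)
  qed
qed

lemma measurable_qm: "qms S X \<Longrightarrow> qms S Y \<Longrightarrow> f \<in> qm X Y \<Longrightarrow> f \<in> ind S X \<rightarrow>\<^sub>M ind S Y"
  by (blast intro: measurable_indI measurable_rv qm_rv)

text \<open>A random variable of \<Omega> \<times> \<Omega> is a pair of endomorphisms, so joint
  admissibility is tested on such pairs. A constant paired with the identity shows that each
  \<open>\<xi> w\<close> is a random variable. Parametrised families are checked by this criterion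
  throughout.\<close>

lemma rvs2_iff:
  assumes "qms S X"
  shows "\<xi> \<in> rvs2 S X \<longleftrightarrow> (\<forall>\<Phi>\<in>endos S. \<forall>\<Psi>\<in>endos S. (\<lambda>u. \<xi> (\<Phi> u) (\<Psi> u)) \<in> rvs X)"
proof
  assume "\<xi> \<in> rvs2 S X"
  then show "\<forall>\<Phi>\<in>endos S. \<forall>\<Psi>\<in>endos S. (\<lambda>u. \<xi> (\<Phi> u) (\<Psi> u)) \<in> rvs X"
    unfolding rvs2_def using qm_rv[OF _ rvs_qprodI, of _ "qOmega S" "qOmega S"] by fastforce
next
  assume *: "\<forall>\<Phi>\<in>endos S. \<forall>\<Psi>\<in>endos S. (\<lambda>u. \<xi> (\<Phi> u) (\<Psi> u)) \<in> rvs X"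
  then have "\<xi> w \<in> rvs X" for w
    using const_endo[of w] id_endo by auto
  moreover have "(\<lambda>(w, w'). \<xi> w w') \<in> qm (qOmega S \<otimes>\<^sub>q qOmega S) X"
    using * by (intro qmI[OF qms_qprod[OF qms_Omega qms_Omega] assms]) (auto elim!: qprod_rvE)
  ultimately show "\<xi> \<in> rvs2 S X"
    by (auto simp: rvs2_def)
qed

lemma rvs2_rv: "\<xi> \<in> rvs2 S X \<Longrightarrow> \<xi> w \<in> rvs X"
  by (auto simp: rvs2_def)

text \<open>The coordinates are exchanged: the parameter \<open>w\<close> comes second, so that the
  fibres over \<open>w\<close> are the ones measured in conditions (ii) and (iii).\<close>

lemma rvs2_fibre_sets:
  assumes "qms S X" "\<xi> \<in> rvs2 S X" "A \<in> sets (ind S X)"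
  shows "{(v, w). \<xi> w v \<in> A} \<in> ind_sets S (qOmega S \<otimes>\<^sub>q qOmega S)"
  unfolding ind_sets_def
proof (intro CollectI conjI ballI)
  fix \<gamma> assume "\<gamma> \<in> rvs (qOmega S \<otimes>\<^sub>q qOmega S)"
  then obtain \<Phi> \<Psi> where *: "\<Phi> \<in> endos S" "\<Psi> \<in> endos S" "\<gamma> = (\<lambda>w. (\<Phi> w, \<Psi> w))"
    by (auto elim!: qprod_rvE)
  then have "(\<lambda>u. \<xi> (\<Psi> u) (\<Phi> u)) \<in> rvs X"
    using assms by (simp add: rvs2_iff)
  then have "(\<lambda>u. \<xi> (\<Psi> u) (\<Phi> u)) -` A \<in> events S"
    using assms by (simp add: sets_ind[OF sample_space] ind_sets_def)
  then show "\<gamma> -` {(v, w). \<xi> w v \<in> A} \<in> events S"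
    by (simp add: * vimage_def)
qed simp

section \<open>The spaces \<open>PP S X\<close> and their random variables as kernels\<close>

lemma qms_PP:
  assumes "qms S X"
  shows "qms S (PP S X)"
  unfolding qms_def
proof (intro conjI ballI)
  show "rvs (PP S X) \<subseteq> UNIV \<rightarrow> pts (PP S X)"
    by (auto simp: PP_def rvs2_def)
  show "(\<lambda>_. \<mu>) \<in> rvs (PP S X)" if "\<mu> \<in> pts (PP S X)" for \<mu>
    using that
  proof (rule PP_ptE)
    fix P \<alpha> assume "P \<in> probs S" "\<alpha> \<in> rvs X" "\<mu> = distr P (ind S X) \<alpha>"
    moreover have "(\<lambda>_. \<alpha>) \<in> rvs2 S X"
      using assms \<open>\<alpha> \<in> rvs X\<close> by (auto simp: rvs2_iff intro: qms_rv_comp)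
    ultimately show ?thesis
      by (auto intro: PP_rvI)
  qed
  show "\<gamma> \<circ> \<Phi> \<in> rvs (PP S X)" if \<gamma>: "\<gamma> \<in> rvs (PP S X)" and \<Phi>: "\<Phi> \<in> endos S" for \<gamma> \<Phi>
    using \<gamma>
  proof (rule PP_rvE)
    fix P \<xi> assume "P \<in> probs S" and \<xi>: "\<xi> \<in> rvs2 S X" and "\<gamma> = (\<lambda>w. distr P (ind S X) (\<xi> w))"
    moreover have "(\<lambda>w. \<xi> (\<Phi> w)) \<in> rvs2 S X"
      using assms \<xi> endo_comp[OF \<Phi>] by (auto simp: rvs2_iff)
    ultimately show ?thesis
      by (auto intro: PP_rvI simp: comp_def)
  qed
qed

lemma sets_PP: "\<mu> \<in> pts (PP S X) \<Longrightarrow> sets \<mu> = sets (ind S X)"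
  by (auto simp: PP_def)

lemma space_PP: "\<mu> \<in> pts (PP S X) \<Longrightarrow> space \<mu> = pts X"
  by (auto simp: PP_def)

lemma prob_space_PP:
  assumes "qms S X" "\<mu> \<in> pts (PP S X)"
  shows "prob_space \<mu>"
  using assms by (auto elim!: PP_ptE intro: prob_space.prob_space_distr prob_space_probs measurable_probs_rv)

text \<open>The mass of \<open>A\<close> under \<open>\<gamma> w\<close> is the
  \<open>P\<close>-measure of the fibre over \<open>w\<close> of a single set in \<Omega> \<times>
  \<Omega>, and condition (ii) governs how this depends on \<open>w\<close>. Having one
  \<open>P\<close> for all \<open>w\<close> is essential here.\<close>

lemma measurable_kernel_rv:
  assumes X: "qms S X" and \<gamma>: "\<gamma> \<in> rvs (PP S X)"
  shows "\<gamma> \<in> event_space S \<rightarrow>\<^sub>M subprob_algebra (ind S X)"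
proof (rule measurable_subprob_algebra)
  have pt: "\<gamma> w \<in> pts (PP S X)" for w
    using qms_rv_pts[OF qms_PP[OF X] \<gamma>] .
  show "subprob_space (\<gamma> w)" "sets (\<gamma> w) = sets (ind S X)" for w
    using prob_space_PP[OF X pt] sets_PP[OF pt] by (auto intro: prob_space_imp_subprob_space)
  show "(\<lambda>w. emeasure (\<gamma> w) A) \<in> borel_measurable (event_space S)" if A: "A \<in> sets (ind S X)" for A
  proof -
    obtain P \<xi> where P: "P \<in> probs S" and \<xi>: "\<xi> \<in> rvs2 S X" and eq: "\<gamma> = (\<lambda>w. distr P (ind S X) (\<xi> w))"
      using \<gamma> by (rule PP_rvE)
    have "(\<lambda>w. emeasure P {v. (v, w) \<in> {(v, w). \<xi> w v \<in> A}}) \<in> borel_measurable (event_space S)"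
      using product_compatible P rvs2_fibre_sets[OF X \<xi> A] unfolding product_compatible_def by blast
    moreover have "emeasure (\<gamma> w) A = emeasure P {v. (v, w) \<in> {(v, w). \<xi> w v \<in> A}}" for w
      using emeasure_distr[OF measurable_probs_rv[OF P X rvs2_rv[OF \<xi>]] A] space_probs[OF P]
      by (simp add: eq vimage_def)
    ultimately show ?thesis
      by simp
  qed
qed

lemma measurable_kernel:
  assumes "qms S Z" "qms S X" "h \<in> qm Z (PP S X)"
  shows "h \<in> ind S Z \<rightarrow>\<^sub>M subprob_algebra (ind S X)"
  using assms by (blast intro: measurable_indI measurable_kernel_rv qm_rv)

section \<open>Composition of kernels\<close>

text \<open>Condition (iii) of product compatibility; \<open>R\<close>, \<open>\<Phi>1\<close> and \<open>\<Phi>2\<close> depend on the measures only, which is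
  what makes the multiplication a morphism.\<close>

definition fuses :: "'o measure \<Rightarrow> 'o measure \<Rightarrow> 'o measure \<Rightarrow> ('o \<Rightarrow> 'o) \<Rightarrow> ('o \<Rightarrow> 'o) \<Rightarrow> bool" where
  "fuses P1 P2 R \<Phi>1 \<Phi>2 \<longleftrightarrow> R \<in> probs S \<and> \<Phi>1 \<in> endos S \<and> \<Phi>2 \<in> endos S \<and>
     (\<forall>D\<in>ind_sets S (qOmega S \<otimes>\<^sub>q qOmega S).
        (\<integral>\<^sup>+ w2. emeasure P1 {w1. (w1, w2) \<in> D} \<partial>P2) = emeasure R ((\<lambda>w. (\<Phi>1 w, \<Phi>2 w)) -` D))"

lemma fuses_exists:
  assumes "P1 \<in> probs S" "P2 \<in> probs S"
  obtains R \<Phi>1 \<Phi>2 where "fuses P1 P2 R \<Phi>1 \<Phi>2"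
proof -
  have "\<forall>P1\<in>probs S. \<forall>P2\<in>probs S. \<exists>P\<in>probs S. \<exists>\<Phi>1\<in>endos S. \<exists>\<Phi>2\<in>endos S. fuses P1 P2 P \<Phi>1 \<Phi>2"
    using product_compatible unfolding product_compatible_def fuses_def by simp
  with assms that show ?thesis
    by blast
qed

text \<open>At a set \<open>A\<close>, the two sides are those of condition (iii) for the set of
  pairs \<open>(v, w)\<close> with \<open>\<xi> w v \<in> A\<close>. The inner variable is replaced
  by \<open>\<Phi>1\<close>, the outer one by \<open>\<Phi>2\<close>.\<close>

lemma bind_fuses:
  assumes X: "qms S X" and \<xi>: "\<xi> \<in> rvs2 S X" and P: "P1 \<in> probs S" "P2 \<in> probs S"
    and fuses: "fuses P1 P2 R \<Phi>1 \<Phi>2"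
  shows "P2 \<bind> (\<lambda>w. distr P1 (ind S X) (\<xi> w)) = distr R (ind S X) (\<lambda>u. \<xi> (\<Phi>2 u) (\<Phi>1 u))"
proof (rule measure_eqI)
  have R: "R \<in> probs S" "\<Phi>1 \<in> endos S" "\<Phi>2 \<in> endos S"
    using fuses by (auto simp: fuses_def)
  have ne: "space P2 \<noteq> {}"
    by (simp add: space_probs[OF P(2)])
  have kernel: "(\<lambda>w. distr P1 (ind S X) (\<xi> w)) \<in> P2 \<rightarrow>\<^sub>M subprob_algebra (ind S X)"
    by (rule measurable_probs[OF P(2) measurable_kernel_rv[OF X PP_rvI[OF P(1) \<xi>]]])
  have rv: "(\<lambda>u. \<xi> (\<Phi>2 u) (\<Phi>1 u)) \<in> rvs X"
    using \<xi> R by (simp add: rvs2_iff[OF X])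
  show sets: "sets (P2 \<bind> (\<lambda>w. distr P1 (ind S X) (\<xi> w))) = sets (distr R (ind S X) (\<lambda>u. \<xi> (\<Phi>2 u) (\<Phi>1 u)))"
    using ne by simp
  fix A assume "A \<in> sets (P2 \<bind> (\<lambda>w. distr P1 (ind S X) (\<xi> w)))"
  then have A: "A \<in> sets (ind S X)"
    by (simp add: sets)
  have "emeasure (distr P1 (ind S X) (\<xi> w)) A = emeasure P1 {v. (v, w) \<in> {(v, w). \<xi> w v \<in> A}}" for w
    using emeasure_distr[OF measurable_probs_rv[OF P(1) X rvs2_rv[OF \<xi>]] A] space_probs[OF P(1)]
    by (simp add: vimage_def)
  then have "emeasure (P2 \<bind> (\<lambda>w. distr P1 (ind S X) (\<xi> w))) A =
      (\<integral>\<^sup>+ w. emeasure P1 {v. (v, w) \<in> {(v, w). \<xi> w v \<in> A}} \<partial>P2)"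
    by (simp add: emeasure_bind[OF ne kernel A])
  also have "\<dots> = emeasure R ((\<lambda>w. (\<Phi>1 w, \<Phi>2 w)) -` {(v, w). \<xi> w v \<in> A})"
    using fuses rvs2_fibre_sets[OF X \<xi> A] unfolding fuses_def by blast
  also have "\<dots> = emeasure (distr R (ind S X) (\<lambda>u. \<xi> (\<Phi>2 u) (\<Phi>1 u))) A"
    using emeasure_distr[OF measurable_probs_rv[OF R(1) X rv] A] space_probs[OF R(1)]
    by (simp add: vimage_def)
  finally show "emeasure (P2 \<bind> (\<lambda>w. distr P1 (ind S X) (\<xi> w))) A =
      emeasure (distr R (ind S X) (\<lambda>u. \<xi> (\<Phi>2 u) (\<Phi>1 u))) A" .
qed

section \<open>The calculus of \<open>bind\<close> and \<open>distr\<close> for morphisms\<close>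

lemma measurable_PP: "\<mu> \<in> pts (PP S X) \<Longrightarrow> f \<in> ind S X \<rightarrow>\<^sub>M N \<Longrightarrow> f \<in> \<mu> \<rightarrow>\<^sub>M N"
  using measurable_cong_sets[OF sets_PP refl] by blast

text \<open>On an empty space \<open>bind\<close> takes a default value, so many of its rules ask
  for a non-empty one; total mass one provides it.\<close>

lemma PP_not_empty: "qms S X \<Longrightarrow> \<mu> \<in> pts (PP S X) \<Longrightarrow> space \<mu> \<noteq> {}"
  by (rule prob_space.not_empty[OF prob_space_PP])

lemma bind_PP_cong: "\<mu> \<in> pts (PP S X) \<Longrightarrow> (\<And>x. x \<in> pts X \<Longrightarrow> h x = k x) \<Longrightarrow> \<mu> \<bind> h = \<mu> \<bind> k"
  by (intro bind_cong) (simp_all add: space_PP)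

lemma bind_distr_qm:
  assumes "qms S X" "qms S Y" "qms S Z" "\<mu> \<in> pts (PP S X)" "f \<in> qm X Y" "h \<in> qm Y (PP S Z)"
  shows "distr \<mu> (ind S Y) f \<bind> h = \<mu> \<bind> (\<lambda>x. h (f x))"
  by (rule bind_distr[OF measurable_PP[OF assms(4) measurable_qm[OF assms(1,2,5)]]
        measurable_kernel[OF assms(2,3,6)] PP_not_empty[OF assms(1,4)]])

lemma distr_bind_qm:
  assumes "qms S X" "qms S Y" "qms S Z" "\<mu> \<in> pts (PP S X)" "h \<in> qm X (PP S Y)" "f \<in> qm Y Z"
  shows "distr (\<mu> \<bind> h) (ind S Z) f = \<mu> \<bind> (\<lambda>x. distr (h x) (ind S Z) f)"
  by (rule distr_bind[OF measurable_PP[OF assms(4) measurable_kernel[OF assms(1,2,5)]]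
        PP_not_empty[OF assms(1,4)] measurable_qm[OF assms(2,3,6)]])

lemma bind_assoc_qm:
  assumes "qms S X" "qms S Y" "qms S Z" "\<mu> \<in> pts (PP S X)" "h \<in> qm X (PP S Y)" "k \<in> qm Y (PP S Z)"
  shows "(\<mu> \<bind> h) \<bind> k = \<mu> \<bind> (\<lambda>x. h x \<bind> k)"
  by (rule bind_assoc[OF measurable_PP[OF assms(4) measurable_kernel[OF assms(1,2,5)]]
        measurable_kernel[OF assms(2,3,6)]])

lemma distr_distr_qm:
  assumes "qms S X" "qms S Y" "qms S Z" "\<mu> \<in> pts (PP S X)" "f \<in> qm X Y" "g \<in> qm Y Z"
  shows "distr (distr \<mu> (ind S Y) f) (ind S Z) g = distr \<mu> (ind S Z) (\<lambda>x. g (f x))"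
  using distr_distr[OF measurable_qm[OF assms(2,3,6)] measurable_PP[OF assms(4) measurable_qm[OF assms(1,2,5)]]]
  by (simp add: comp_def)

section \<open>The monad\<close>

lemma qm_pushf:
  assumes X: "qms S X" and Y: "qms S Y" and f: "f \<in> qm X Y"
  shows "pushf S Y f \<in> qm (PP S X) (PP S Y)"
proof (rule qmI[OF qms_PP[OF X] qms_PP[OF Y]])
  fix \<gamma> assume "\<gamma> \<in> rvs (PP S X)"
  then obtain P \<xi> where P: "P \<in> probs S" and \<xi>: "\<xi> \<in> rvs2 S X" and eq: "\<gamma> = (\<lambda>w. distr P (ind S X) (\<xi> w))"
    by (rule PP_rvE)
  have "pushf S Y f (\<gamma> w) = distr P (ind S Y) (\<lambda>v. f (\<xi> w v))" for w
    using distr_distr[OF measurable_qm[OF X Y f] measurable_probs_rv[OF P X rvs2_rv[OF \<xi>]]]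
    by (simp add: eq pushf_def comp_def)
  moreover have "(\<lambda>w v. f (\<xi> w v)) \<in> rvs2 S Y"
    using \<xi> qm_rv[OF f] by (simp add: rvs2_iff X Y)
  ultimately show "(\<lambda>w. pushf S Y f (\<gamma> w)) \<in> rvs (PP S Y)"
    using PP_rvI[OF P] by simp
qed

text \<open>A Dirac measure is the push-forward of any probability along a constant map, so one
  arbitrary \<open>P\<close> serves for all parameters.\<close>

lemma qm_dirac:
  assumes X: "qms S X"
  shows "dirac S X \<in> qm X (PP S X)"
proof (rule qmI[OF X qms_PP[OF X]])
  fix \<alpha> assume \<alpha>: "\<alpha> \<in> rvs X"
  obtain P where P: "P \<in> probs S"
    using probs_nonempty by blast
  have "dirac S X (\<alpha> w) = distr P (ind S X) (\<lambda>_. \<alpha> w)" for w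
    using prob_space.distr_const[OF prob_space_probs[OF P], of "\<alpha> w" "ind S X"] qms_rv_pts[OF X \<alpha>]
    by (simp add: dirac_def)
  moreover have "(\<lambda>w _. \<alpha> w) \<in> rvs2 S X"
    using qms_rv_comp[OF X \<alpha>] by (simp add: rvs2_iff X)
  ultimately show "(\<lambda>w. dirac S X (\<alpha> w)) \<in> rvs (PP S X)"
    using PP_rvI[OF P] by simp
qed

lemma dirac_pts: "qms S X \<Longrightarrow> x \<in> pts X \<Longrightarrow> dirac S X x \<in> pts (PP S X)"
  by (rule qm_pts[OF qm_dirac])

lemma dirac_bind:
  assumes "qms S X" "qms S Y" "h \<in> qm X (PP S Y)" "x \<in> pts X"
  shows "dirac S X x \<bind> h = h x"
  unfolding dirac_def using assms by (intro bind_return[where N="ind S Y"]) (auto intro: measurable_kernel)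

lemma pushf_dirac:
  assumes "qms S X" "qms S Y" "f \<in> qm X Y" "x \<in> pts X"
  shows "pushf S Y f (dirac S X x) = dirac S Y (f x)"
  unfolding dirac_def pushf_def using assms by (intro distr_return) (auto intro: measurable_qm)

lemma bind_dirac: "\<mu> \<in> pts (PP S X) \<Longrightarrow> \<mu> \<bind> dirac S X = \<mu>"
  unfolding dirac_def by (simp add: bind_return'' sets_PP)

text \<open>Read as a morphism from \<open>PP S X\<close> to itself, the identity is the kernel
  whose \<open>bind\<close> is the multiplication.\<close>

lemma qm_ident: "(\<lambda>x. x) \<in> qm X X"
  by (simp add: qm_def comp_def)

lemma mult_eq_bind:
  assumes X: "qms S X" and \<pi>: "\<pi> \<in> pts (PP S (PP S X))"
  shows "mult S X \<pi> = \<pi> \<bind> (\<lambda>\<mu>. \<mu>)"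
proof -
  have kernel: "(\<lambda>\<mu>. \<mu>) \<in> \<pi> \<rightarrow>\<^sub>M subprob_algebra (ind S X)"
    by (rule measurable_PP[OF \<pi> measurable_kernel[OF qms_PP[OF X] X qm_ident]])
  have ne: "space \<pi> \<noteq> {}"
    by (rule PP_not_empty[OF qms_PP[OF X] \<pi>])
  show ?thesis
    unfolding mult_def
  proof (rule measure_of_ind_eq[OF sample_space X])
    show "sets (\<pi> \<bind> (\<lambda>\<mu>. \<mu>)) = sets (ind S X)"
      by (rule sets_bind[OF _ ne]) (simp add: space_PP[OF \<pi>] sets_PP)
  qed (simp add: emeasure_bind[OF ne kernel])
qed

text \<open>This is Kleisli extension: every composite of \<open>mult\<close> with a
  \<open>pushf\<close> in the laws collapses to one \<open>bind\<close>.\<close>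

lemma mult_pushf:
  assumes "qms S Z" "qms S X" "\<pi> \<in> pts (PP S Z)" "h \<in> qm Z (PP S X)"
  shows "mult S X (pushf S (PP S X) h \<pi>) = \<pi> \<bind> h"
proof -
  have "mult S X (pushf S (PP S X) h \<pi>) = pushf S (PP S X) h \<pi> \<bind> (\<lambda>\<mu>. \<mu>)"
    by (rule mult_eq_bind[OF assms(2) qm_pts[OF qm_pushf[OF assms(1) qms_PP[OF assms(2)] assms(4)] assms(3)]])
  also have "\<dots> = \<pi> \<bind> h"
    unfolding pushf_def using bind_distr_qm[OF assms(1) qms_PP[OF assms(2)] assms(2-4) qm_ident] .
  finally show ?thesis .
qed

text \<open>The isomorphism turns a random variable of \<open>PP X\<close> on \<open>\<Omega> \<times> \<Omega>\<close> into one on \<open>\<Omega>\<close>, so that all its values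
  are push-forwards of the same member of \<open>probs\<close>.\<close>

lemma qm_mult:
  assumes iso: "qiso (qOmega S) (qOmega S \<otimes>\<^sub>q qOmega S)" and X: "qms S X"
  shows "mult S X \<in> qm (PP S (PP S X)) (PP S X)"
proof (rule qmI[OF qms_PP[OF qms_PP[OF X]] qms_PP[OF X]])
  fix \<gamma> assume \<gamma>: "\<gamma> \<in> rvs (PP S (PP S X))"
  then obtain P \<zeta> where P: "P \<in> probs S" and \<zeta>: "\<zeta> \<in> rvs2 S (PP S X)"
    and \<gamma>_eq: "\<gamma> = (\<lambda>w. distr P (ind S (PP S X)) (\<zeta> w))"
    by (rule PP_rvE)
  obtain f g where f: "f \<in> qm (qOmega S) (qOmega S \<otimes>\<^sub>q qOmega S)" and g: "g \<in> qm (qOmega S \<otimes>\<^sub>q qOmega S) (qOmega S)"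
    and fg: "\<And>p. f (g p) = p"
    using iso by (auto simp: qiso_def)
  have "(\<lambda>u. fst (f u)) \<in> endos S" "(\<lambda>u. snd (f u)) \<in> endos S"
    using qm_rv[OF f, of "\<lambda>u. u"] id_endo by (simp_all add: rvs_qprod_iff)
  then have "(\<lambda>u. \<zeta> (fst (f u)) (snd (f u))) \<in> rvs (PP S X)"
    using \<zeta> by (simp add: rvs2_iff qms_PP X)
  then obtain Q \<xi> where Q: "Q \<in> probs S" and \<xi>: "\<xi> \<in> rvs2 S X"
    and eq: "(\<lambda>u. \<zeta> (fst (f u)) (snd (f u))) = (\<lambda>u. distr Q (ind S X) (\<xi> u))"
    by (rule PP_rvE)
  \<comment> \<open>The measure \<open>Q\<close> belongs to the single random variable over encoded
    pairs \<open>u\<close>; decoding at \<open>g (w, w')\<close> therefore gives the same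
    \<open>Q\<close> for every \<open>w\<close>.\<close>
  have \<zeta>_eq: "\<zeta> w = (\<lambda>w'. distr Q (ind S X) (\<xi> (g (w, w'))))" for w
  proof
    fix w' show "\<zeta> w w' = distr Q (ind S X) (\<xi> (g (w, w')))"
      using fun_cong[OF eq, of "g (w, w')"] by (simp add: fg)
  qed
  have g_endo: "(\<lambda>u. g (\<Phi> u, \<Psi> u)) \<in> endos S" if "\<Phi> \<in> endos S" "\<Psi> \<in> endos S" for \<Phi> \<Psi>
    using qm_rv[OF g rvs_qprodI] that by simp
  obtain R \<Phi>1 \<Phi>2 where R: "fuses Q P R \<Phi>1 \<Phi>2"
    using fuses_exists[OF Q P] .
  then have R': "R \<in> probs S" "\<Phi>1 \<in> endos S" "\<Phi>2 \<in> endos S"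
    by (auto simp: fuses_def)
  have "mult S X (\<gamma> w) = distr R (ind S X) (\<lambda>u. \<xi> (g (w, \<Phi>2 u)) (\<Phi>1 u))" for w
  proof -
    have "mult S X (\<gamma> w) = distr P (ind S (PP S X)) (\<zeta> w) \<bind> (\<lambda>\<mu>. \<mu>)"
      using mult_eq_bind[OF X qms_rv_pts[OF qms_PP[OF qms_PP[OF X]] \<gamma>]] by (simp add: \<gamma>_eq)
    also have "\<dots> = P \<bind> \<zeta> w"
      by (rule bind_distr[OF measurable_probs_rv[OF P qms_PP[OF X] rvs2_rv[OF \<zeta>]]
            measurable_kernel[OF qms_PP[OF X] X qm_ident]])
        (simp add: space_probs[OF P])
    also have "\<dots> = distr R (ind S X) (\<lambda>u. \<xi> (g (w, \<Phi>2 u)) (\<Phi>1 u))"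
      unfolding \<zeta>_eq
    proof (rule bind_fuses[OF X _ Q P R])
      show "(\<lambda>w'. \<xi> (g (w, w'))) \<in> rvs2 S X"
        using \<xi> g_endo[OF const_endo] by (simp add: rvs2_iff X)
    qed
    finally show ?thesis .
  qed
  \<comment> \<open>After substituting endomorphisms for \<open>w\<close> and \<open>u\<close>, both
    arguments of \<open>\<xi>\<close> are endomorphisms, because \<open>g\<close> is a morphism on
    pairs.\<close>
  moreover have "(\<lambda>w u. \<xi> (g (w, \<Phi>2 u)) (\<Phi>1 u)) \<in> rvs2 S X"
    using \<xi> g_endo endo_comp R' by (simp add: rvs2_iff X)
  ultimately show "(\<lambda>w. mult S X (\<gamma> w)) \<in> rvs (PP S X)"
    using PP_rvI[OF R'(1)] by simp
qed

lemma pushf_id: "\<mu> \<in> pts (PP S X) \<Longrightarrow> pushf S X id \<mu> = \<mu>"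
  unfolding pushf_def id_def by (rule distr_id2) (simp add: sets_PP)

lemma pushf_comp:
  assumes "qms S X" "qms S Y" "qms S Z" "f \<in> qm X Y" "g \<in> qm Y Z" "\<mu> \<in> pts (PP S X)"
  shows "pushf S Z (g \<circ> f) \<mu> = pushf S Z g (pushf S Y f \<mu>)"
  using distr_distr_qm[OF assms(1-3,6,4,5)] by (simp add: pushf_def comp_def)

lemma pushf_mult:
  assumes X: "qms S X" and Y: "qms S Y" and f: "f \<in> qm X Y" and \<pi>: "\<pi> \<in> pts (PP S (PP S X))"
  shows "pushf S Y f (mult S X \<pi>) = mult S Y (pushf S (PP S Y) (pushf S Y f) \<pi>)"
  unfolding mult_eq_bind[OF X \<pi>] mult_pushf[OF qms_PP[OF X] Y \<pi> qm_pushf[OF X Y f]]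
  using distr_bind_qm[OF qms_PP[OF X] X Y \<pi> qm_ident f] by (simp add: pushf_def[abs_def])

lemma mult_dirac:
  assumes "qms S X" "\<mu> \<in> pts (PP S X)"
  shows "mult S X (dirac S (PP S X) \<mu>) = \<mu>"
  using assms by (simp add: mult_eq_bind dirac_pts qms_PP dirac_bind[OF _ _ qm_ident])

lemma mult_pushf_dirac:
  assumes "qms S X" "\<mu> \<in> pts (PP S X)"
  shows "mult S X (pushf S (PP S X) (dirac S X) \<mu>) = \<mu>"
  using assms by (simp add: mult_pushf[OF assms(1,1)] qm_dirac bind_dirac)

lemma mult_mult:
  assumes iso: "qiso (qOmega S) (qOmega S \<otimes>\<^sub>q qOmega S)"
    and X: "qms S X" and \<theta>: "\<theta> \<in> pts (PP S (PP S (PP S X)))"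
  shows "mult S X (mult S (PP S X) \<theta>) = mult S X (pushf S (PP S X) (mult S X) \<theta>)"
proof -
  note PX = qms_PP[OF X] note PPX = qms_PP[OF PX]
  \<comment> \<open>Rewriting the outer \<open>mult\<close> as a \<open>bind\<close> requires the
    inner value to be a point of \<open>PP S (PP S X)\<close>, which is supplied by
    \<open>qm_mult\<close>.\<close>
  have "mult S X (mult S (PP S X) \<theta>) = (\<theta> \<bind> (\<lambda>\<pi>. \<pi>)) \<bind> (\<lambda>\<mu>. \<mu>)"
    using qm_pts[OF qm_mult[OF iso PX] \<theta>] by (simp add: mult_eq_bind X PX \<theta>)
  also have "\<dots> = \<theta> \<bind> (\<lambda>\<pi>. \<pi> \<bind> (\<lambda>\<mu>. \<mu>))"
    by (rule bind_assoc_qm[OF PPX PX X \<theta> qm_ident qm_ident])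
  also have "\<dots> = \<theta> \<bind> mult S X"
    by (rule bind_PP_cong[OF \<theta>]) (simp add: mult_eq_bind X)
  also have "\<dots> = mult S X (pushf S (PP S X) (mult S X) \<theta>)"
    by (rule mult_pushf[OF PPX X \<theta> qm_mult[OF iso X], symmetric])
  finally show ?thesis .
qed

lemma PP_qone:
  assumes "\<mu> \<in> pts (PP S (qone :: ('o, unit) qspace))"
  shows "\<mu> = dirac S qone ()"
  using assms
proof (rule PP_ptE)
  fix P and \<alpha> :: "'o \<Rightarrow> unit" assume "P \<in> probs S" "\<mu> = distr P (ind S qone) \<alpha>"
  \<comment> \<open>There is only one map into the one-point type, and pushing any probability along
    a constant gives the Dirac measure.\<close>
  moreover have "\<alpha> = (\<lambda>_. ())"
    by auto
  ultimately show ?thesis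
    using prob_space.distr_const[OF prob_space_probs, of P "()" "ind S qone"]
    by (simp add: dirac_def qone_def)
qed

lemma affine: "affine_monad S"
  unfolding affine_monad_def qiso_def
proof (intro bexI[of _ "\<lambda>_. ()"] bexI[of _ "dirac S qone"])
  show "dirac S qone \<in> qm (qone :: ('o, unit) qspace) (PP S qone)"
    by (rule qm_dirac[OF qms_qone])
  show "(\<lambda>_. ()) \<in> qm (PP S (qone :: ('o, unit) qspace)) qone"
    by (simp add: qm_def qone_def)
qed (auto dest: PP_qone)

section \<open>The product of measures\<close>

text \<open>Along \<open>\<beta>\<close>, the probability \<open>P\<close> and the map
  \<open>\<alpha>\<close> representing \<open>\<mu>\<close> stay fixed and only the second
  coordinate \<open>\<beta> w\<close> moves. This is the kernel behind every product of
  measures.\<close>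

lemma qm_section_left:
  assumes X: "qms S X" and Y: "qms S Y" and \<mu>: "\<mu> \<in> pts (PP S X)"
  shows "(\<lambda>y. distr \<mu> (ind S (X \<otimes>\<^sub>q Y)) (\<lambda>x. (x, y))) \<in> qm Y (PP S (X \<otimes>\<^sub>q Y))"
proof (rule qmI[OF Y qms_PP[OF qms_qprod[OF X Y]]])
  fix \<beta> assume \<beta>: "\<beta> \<in> rvs Y"
  note XY = qms_qprod[OF X Y]
  obtain P \<alpha> where P: "P \<in> probs S" and \<alpha>: "\<alpha> \<in> rvs X" and eq: "\<mu> = distr P (ind S X) \<alpha>"
    using \<mu> by (rule PP_ptE)
  have "distr \<mu> (ind S (X \<otimes>\<^sub>q Y)) (\<lambda>x. (x, \<beta> w)) = distr P (ind S (X \<otimes>\<^sub>q Y)) (\<lambda>v. (\<alpha> v, \<beta> w))" for w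
    using distr_distr[OF measurable_qm[OF X XY qm_Pair_right[OF X Y qms_rv_pts[OF Y \<beta>]]]
        measurable_probs_rv[OF P X \<alpha>]]
    by (simp add: eq comp_def)
  moreover have "(\<lambda>w v. (\<alpha> v, \<beta> w)) \<in> rvs2 S (X \<otimes>\<^sub>q Y)"
    using qms_rv_comp[OF X \<alpha>] qms_rv_comp[OF Y \<beta>] by (simp add: rvs2_iff XY rvs_qprod_iff)
  ultimately show "(\<lambda>w. distr \<mu> (ind S (X \<otimes>\<^sub>q Y)) (\<lambda>x. (x, \<beta> w))) \<in> rvs (PP S (X \<otimes>\<^sub>q Y))"
    using PP_rvI[OF P] by simp
qed

lemma tensor_eq_bind:
  assumes X: "qms S X" and Y: "qms S Y" and \<mu>: "\<mu> \<in> pts (PP S X)" and \<nu>: "\<nu> \<in> pts (PP S Y)"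
  shows "tensor S X Y \<mu> \<nu> = \<nu> \<bind> (\<lambda>y. distr \<mu> (ind S (X \<otimes>\<^sub>q Y)) (\<lambda>x. (x, y)))" (is "_ = ?M")
  unfolding tensor_def
proof (rule measure_of_ind_eq[OF sample_space qms_qprod[OF X Y]])
  have ne: "space \<nu> \<noteq> {}"
    by (rule PP_not_empty[OF Y \<nu>])
  note kernel = measurable_PP[OF \<nu> measurable_kernel[OF Y qms_qprod[OF X Y] qm_section_left[OF X Y \<mu>]]]
  show "sets ?M = sets (ind S (X \<otimes>\<^sub>q Y))"
    using ne by simp
  fix D assume D: "D \<in> sets (ind S (X \<otimes>\<^sub>q Y))"
  then have sub: "D \<subseteq> pts X \<times> pts Y"
    using sets.sets_into_space[OF D] by simp
  have "emeasure ?M D = (\<integral>\<^sup>+ y. emeasure (distr \<mu> (ind S (X \<otimes>\<^sub>q Y)) (\<lambda>x. (x, y))) D \<partial>\<nu>)"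
    by (rule emeasure_bind[OF ne kernel D])
  also have "\<dots> = (\<integral>\<^sup>+ y. emeasure \<mu> {x. (x, y) \<in> D} \<partial>\<nu>)"
  proof (rule nn_integral_cong)
    fix y assume "y \<in> space \<nu>"
    then have y: "y \<in> pts Y"
      by (simp add: space_PP[OF \<nu>])
    have "(\<lambda>x. (x, y)) \<in> \<mu> \<rightarrow>\<^sub>M ind S (X \<otimes>\<^sub>q Y)"
      by (rule measurable_PP[OF \<mu> measurable_qm[OF X qms_qprod[OF X Y] qm_Pair_right[OF X Y y]]])
    from emeasure_distr[OF this D]
    have "emeasure (distr \<mu> (ind S (X \<otimes>\<^sub>q Y)) (\<lambda>x. (x, y))) D = emeasure \<mu> ((\<lambda>x. (x, y)) -` D \<inter> space \<mu>)" .
    \<comment> \<open>The fibre in \<open>tensor\<close> is not cut down to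
      \<open>space \<mu>\<close>; the two agree because \<open>D\<close> lies in the carrier of the
      product.\<close>
    also have "(\<lambda>x. (x, y)) -` D \<inter> space \<mu> = {x. (x, y) \<in> D}"
      using sub by (auto simp: space_PP[OF \<mu>])
    finally show "emeasure (distr \<mu> (ind S (X \<otimes>\<^sub>q Y)) (\<lambda>x. (x, y))) D = emeasure \<mu> {x. (x, y) \<in> D}" .
  qed
  finally show "(\<integral>\<^sup>+ y. emeasure \<mu> {x. (x, y) \<in> D} \<partial>\<nu>) = emeasure ?M D" ..
qed

text \<open>At each \<open>w\<close> the product is a \<open>Q\<close>-integral of push-forwards of
  \<open>P\<close>, the shape treated by \<open>bind_fuses\<close>. The triple fusing
  \<open>P\<close> and \<open>Q\<close> is chosen before \<open>w\<close>, so the result is again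
  one push-forward with \<open>w\<close> as a parameter.\<close>

lemma qm_tensor:
  assumes X: "qms S X" and Y: "qms S Y"
  shows "(\<lambda>(\<mu>, \<nu>). tensor S X Y \<mu> \<nu>) \<in> qm (PP S X \<otimes>\<^sub>q PP S Y) (PP S (X \<otimes>\<^sub>q Y))"
proof (rule qmI[OF qms_qprod[OF qms_PP[OF X] qms_PP[OF Y]] qms_PP[OF qms_qprod[OF X Y]]])
  note XY = qms_qprod[OF X Y]
  fix \<gamma> assume "\<gamma> \<in> rvs (PP S X \<otimes>\<^sub>q PP S Y)"
  then obtain \<gamma>1 \<gamma>2 where \<gamma>1: "\<gamma>1 \<in> rvs (PP S X)" and \<gamma>2: "\<gamma>2 \<in> rvs (PP S Y)" and eq: "\<gamma> = (\<lambda>w. (\<gamma>1 w, \<gamma>2 w))"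
    by (rule qprod_rvE)
  obtain P \<xi> where P: "P \<in> probs S" and \<xi>: "\<xi> \<in> rvs2 S X" and eq1: "\<gamma>1 = (\<lambda>w. distr P (ind S X) (\<xi> w))"
    using \<gamma>1 by (rule PP_rvE)
  obtain Q \<eta> where Q: "Q \<in> probs S" and \<eta>: "\<eta> \<in> rvs2 S Y" and eq2: "\<gamma>2 = (\<lambda>w. distr Q (ind S Y) (\<eta> w))"
    using \<gamma>2 by (rule PP_rvE)
  obtain R \<Phi>1 \<Phi>2 where R: "fuses P Q R \<Phi>1 \<Phi>2"
    using fuses_exists[OF P Q] .
  then have R': "R \<in> probs S" "\<Phi>1 \<in> endos S" "\<Phi>2 \<in> endos S"
    by (auto simp: fuses_def)
  have "tensor S X Y (\<gamma>1 w) (\<gamma>2 w) = distr R (ind S (X \<otimes>\<^sub>q Y)) (\<lambda>u. (\<xi> w (\<Phi>1 u), \<eta> w (\<Phi>2 u)))" for w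
  proof -
    note pt1 = qms_rv_pts[OF qms_PP[OF X] \<gamma>1] and pt2 = qms_rv_pts[OF qms_PP[OF Y] \<gamma>2]
    have "tensor S X Y (\<gamma>1 w) (\<gamma>2 w)
        = distr Q (ind S Y) (\<eta> w) \<bind> (\<lambda>y. distr (\<gamma>1 w) (ind S (X \<otimes>\<^sub>q Y)) (\<lambda>x. (x, y)))"
      by (simp add: tensor_eq_bind[OF X Y pt1 pt2]) (simp add: eq2)
    also have "\<dots> = Q \<bind> (\<lambda>v. distr (\<gamma>1 w) (ind S (X \<otimes>\<^sub>q Y)) (\<lambda>x. (x, \<eta> w v)))"
      by (rule bind_distr[OF measurable_probs_rv[OF Q Y rvs2_rv[OF \<eta>]]
            measurable_kernel[OF Y XY qm_section_left[OF X Y pt1]]])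
        (simp add: space_probs[OF Q])
    also have "\<dots> = Q \<bind> (\<lambda>v. distr P (ind S (X \<otimes>\<^sub>q Y)) (\<lambda>u. (\<xi> w u, \<eta> w v)))"
    proof (rule bind_cong[OF refl])
      fix v
      have "\<eta> w v \<in> pts Y"
        by (rule qms_rv_pts[OF Y rvs2_rv[OF \<eta>]])
      from distr_distr[OF measurable_qm[OF X XY qm_Pair_right[OF X Y this]]
          measurable_probs_rv[OF P X rvs2_rv[OF \<xi>]]]
      show "distr (\<gamma>1 w) (ind S (X \<otimes>\<^sub>q Y)) (\<lambda>x. (x, \<eta> w v)) = distr P (ind S (X \<otimes>\<^sub>q Y)) (\<lambda>u. (\<xi> w u, \<eta> w v))"
            by (simp add: eq1 comp_def)
    qed
    also have "\<dots> = distr R (ind S (X \<otimes>\<^sub>q Y)) (\<lambda>u. (\<xi> w (\<Phi>1 u), \<eta> w (\<Phi>2 u)))"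
    proof (rule bind_fuses[OF XY _ P Q R])
      show "(\<lambda>v u. (\<xi> w u, \<eta> w v)) \<in> rvs2 S (X \<otimes>\<^sub>q Y)"
        using qms_rv_comp[OF X rvs2_rv[OF \<xi>]] qms_rv_comp[OF Y rvs2_rv[OF \<eta>]]
        by (simp add: rvs2_iff XY rvs_qprod_iff)
    qed
    finally show ?thesis .
  qed
  moreover have "(\<lambda>w u. (\<xi> w (\<Phi>1 u), \<eta> w (\<Phi>2 u))) \<in> rvs2 S (X \<otimes>\<^sub>q Y)"
    using \<xi> \<eta> R' endo_comp by (simp add: rvs2_iff X Y XY rvs_qprod_iff)
  ultimately show "(\<lambda>w. case \<gamma> w of (\<mu>, \<nu>) \<Rightarrow> tensor S X Y \<mu> \<nu>) \<in> rvs (PP S (X \<otimes>\<^sub>q Y))"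
    using PP_rvI[OF R'(1)] by (simp add: eq)
qed

lemma tensor_pts:
  "qms S X \<Longrightarrow> qms S Y \<Longrightarrow> \<mu> \<in> pts (PP S X) \<Longrightarrow> \<nu> \<in> pts (PP S Y) \<Longrightarrow>
    tensor S X Y \<mu> \<nu> \<in> pts (PP S (X \<otimes>\<^sub>q Y))"
  using qm_pts[OF qm_tensor, of X Y "(\<mu>, \<nu>)"] by simp

text \<open>Integration against a product is iterated, with the second factor outermost. Which laws
  need an exchange of integrals can be read off from this order.\<close>

lemma tensor_bind:
  assumes X: "qms S X" and Y: "qms S Y" and Z: "qms S Z"
    and \<mu>: "\<mu> \<in> pts (PP S X)" and \<nu>: "\<nu> \<in> pts (PP S Y)" and h: "h \<in> qm (X \<otimes>\<^sub>q Y) (PP S Z)"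
  shows "tensor S X Y \<mu> \<nu> \<bind> h = \<nu> \<bind> (\<lambda>y. \<mu> \<bind> (\<lambda>x. h (x, y)))"
  unfolding tensor_eq_bind[OF X Y \<mu> \<nu>]
    bind_assoc_qm[OF Y qms_qprod[OF X Y] Z \<nu> qm_section_left[OF X Y \<mu>] h]
  by (intro bind_PP_cong[OF \<nu>] bind_distr_qm[OF X qms_qprod[OF X Y] Z \<mu> qm_Pair_right[OF X Y] h])

lemma pushf_tensor:
  assumes X: "qms S X" and Y: "qms S Y" and Z: "qms S Z"
    and \<mu>: "\<mu> \<in> pts (PP S X)" and \<nu>: "\<nu> \<in> pts (PP S Y)" and h: "h \<in> qm (X \<otimes>\<^sub>q Y) Z"
  shows "pushf S Z h (tensor S X Y \<mu> \<nu>) = \<nu> \<bind> (\<lambda>y. distr \<mu> (ind S Z) (\<lambda>x. h (x, y)))"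
  unfolding tensor_eq_bind[OF X Y \<mu> \<nu>] pushf_def
    distr_bind_qm[OF Y qms_qprod[OF X Y] Z \<nu> qm_section_left[OF X Y \<mu>] h]
  by (intro bind_PP_cong[OF \<nu>] distr_distr_qm[OF X qms_qprod[OF X Y] Z \<mu> qm_Pair_right[OF X Y] h])

section \<open>Strength and costrength\<close>

text \<open>Inserting \<open>x\<close> turns each inner section of the Dirac measure into a Dirac
  measure at \<open>(x, y)\<close>, and \<open>bind\<close> with \<open>return\<close> is a
  push-forward. The strength laws then become composition of maps.\<close>

lemma strength_eq:
  assumes X: "qms S X" and Y: "qms S Y" and x: "x \<in> pts X" and \<nu>: "\<nu> \<in> pts (PP S Y)"
  shows "strength S X Y (x, \<nu>) = distr \<nu> (ind S (X \<otimes>\<^sub>q Y)) (Pair x)"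
proof -
  note XY = qms_qprod[OF X Y]
  have "strength S X Y (x, \<nu>) = \<nu> \<bind> (\<lambda>y. distr (dirac S X x) (ind S (X \<otimes>\<^sub>q Y)) (\<lambda>x. (x, y)))"
    by (simp add: strength_def tensor_eq_bind[OF X Y dirac_pts[OF X x] \<nu>])
  also have "\<dots> = \<nu> \<bind> (\<lambda>y. return (ind S (X \<otimes>\<^sub>q Y)) (x, y))"
    using pushf_dirac[OF X XY qm_Pair_right[OF X Y] x]
    by (intro bind_PP_cong[OF \<nu>]) (simp add: pushf_def dirac_def)
  also have "\<dots> = distr \<nu> (ind S (X \<otimes>\<^sub>q Y)) (Pair x)"
    by (rule bind_return_distr'[OF PP_not_empty[OF Y \<nu>]
          measurable_PP[OF \<nu> measurable_qm[OF Y XY qm_Pair_left[OF X Y x]]]])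
  finally show ?thesis .
qed

text \<open>Here the outer integral is the one against a Dirac measure, so the left unit law of
  \<open>bind\<close> evaluates the section kernel at \<open>y\<close>.\<close>

lemma costrength_eq:
  assumes X: "qms S X" and Y: "qms S Y" and \<mu>: "\<mu> \<in> pts (PP S X)" and y: "y \<in> pts Y"
  shows "costrength S X Y (\<mu>, y) = distr \<mu> (ind S (X \<otimes>\<^sub>q Y)) (\<lambda>x. (x, y))"
  by (simp add: costrength_def tensor_eq_bind[OF X Y \<mu> dirac_pts[OF Y y]]
      dirac_bind[OF Y qms_qprod[OF X Y] qm_section_left[OF X Y \<mu>] y])

lemma qm_strength:
  assumes X: "qms S X" and Y: "qms S Y"
  shows "strength S X Y \<in> qm (X \<otimes>\<^sub>q PP S Y) (PP S (X \<otimes>\<^sub>q Y))"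
  using qm_comp[OF qm_map_prod[OF X qms_PP[OF Y] qms_PP[OF X] qms_PP[OF Y] qm_dirac[OF X] qm_ident]
      qm_tensor[OF X Y]]
  by (simp add: strength_def case_prod_unfold)

lemma qm_costrength:
  assumes X: "qms S X" and Y: "qms S Y"
  shows "costrength S X Y \<in> qm (PP S X \<otimes>\<^sub>q Y) (PP S (X \<otimes>\<^sub>q Y))"
  using qm_comp[OF qm_map_prod[OF qms_PP[OF X] Y qms_PP[OF X] qms_PP[OF Y] qm_ident qm_dirac[OF Y]]
      qm_tensor[OF X Y]]
  by (simp add: costrength_def case_prod_unfold)

lemma strength_pts:
  "qms S X \<Longrightarrow> qms S Y \<Longrightarrow> x \<in> pts X \<Longrightarrow> \<nu> \<in> pts (PP S Y) \<Longrightarrow> strength S X Y (x, \<nu>) \<in> pts (PP S (X \<otimes>\<^sub>q Y))"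
  by (rule qm_pts[OF qm_strength]) simp_all

lemma costrength_pts:
  "qms S X \<Longrightarrow> qms S Y \<Longrightarrow> \<mu> \<in> pts (PP S X) \<Longrightarrow> y \<in> pts Y \<Longrightarrow> costrength S X Y (\<mu>, y) \<in> pts (PP S (X \<otimes>\<^sub>q Y))"
  by (rule qm_pts[OF qm_costrength]) simp_all

lemma pushf_strength:
  assumes X: "qms S X" and Y: "qms S Y" and Z: "qms S Z"
    and h: "h \<in> qm (X \<otimes>\<^sub>q Y) Z" and x: "x \<in> pts X" and \<nu>: "\<nu> \<in> pts (PP S Y)"
  shows "pushf S Z h (strength S X Y (x, \<nu>)) = distr \<nu> (ind S Z) (\<lambda>y. h (x, y))"
  by (simp add: strength_eq[OF X Y x \<nu>] pushf_def
      distr_distr_qm[OF Y qms_qprod[OF X Y] Z \<nu> qm_Pair_left[OF X Y x] h])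

lemma pushf_costrength:
  assumes X: "qms S X" and Y: "qms S Y" and Z: "qms S Z"
    and h: "h \<in> qm (X \<otimes>\<^sub>q Y) Z" and \<mu>: "\<mu> \<in> pts (PP S X)" and y: "y \<in> pts Y"
  shows "pushf S Z h (costrength S X Y (\<mu>, y)) = distr \<mu> (ind S Z) (\<lambda>x. h (x, y))"
  by (simp add: costrength_eq[OF X Y \<mu> y] pushf_def
      distr_distr_qm[OF X qms_qprod[OF X Y] Z \<mu> qm_Pair_right[OF X Y y] h])

lemma strength_natural:
  assumes X: "qms S X" and Y: "qms S Y" and Z: "qms S Z" and W: "qms S W"
    and f: "f \<in> qm X Z" and g: "g \<in> qm Y W" and x: "x \<in> pts X" and \<nu>: "\<nu> \<in> pts (PP S Y)"
  shows "pushf S (Z \<otimes>\<^sub>q W) (map_prod f g) (strength S X Y (x, \<nu>)) = strength S Z W (f x, pushf S W g \<nu>)"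
  unfolding pushf_strength[OF X Y qms_qprod[OF Z W] qm_map_prod[OF X Y Z W f g] x \<nu>]
    strength_eq[OF Z W qm_pts[OF f x] qm_pts[OF qm_pushf[OF Y W g] \<nu>]]
  by (simp add: pushf_def distr_distr_qm[OF Y W qms_qprod[OF Z W] \<nu> g qm_Pair_left[OF Z W qm_pts[OF f x]]])

lemma costrength_natural:
  assumes X: "qms S X" and Y: "qms S Y" and Z: "qms S Z" and W: "qms S W"
    and f: "f \<in> qm X Z" and g: "g \<in> qm Y W" and \<mu>: "\<mu> \<in> pts (PP S X)" and y: "y \<in> pts Y"
  shows "pushf S (Z \<otimes>\<^sub>q W) (map_prod f g) (costrength S X Y (\<mu>, y)) = costrength S Z W (pushf S Z f \<mu>, g y)"
  unfolding pushf_costrength[OF X Y qms_qprod[OF Z W] qm_map_prod[OF X Y Z W f g] \<mu> y]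
    costrength_eq[OF Z W qm_pts[OF qm_pushf[OF X Z f] \<mu>] qm_pts[OF g y]]
  by (simp add: pushf_def distr_distr_qm[OF X Z qms_qprod[OF Z W] \<mu> f qm_Pair_right[OF Z W qm_pts[OF g y]]])

lemma strength_unit:
  assumes X: "qms S X" and \<mu>: "\<mu> \<in> pts (PP S X)"
  shows "pushf S X snd (strength S qone X ((), \<mu>)) = \<mu>"
  using pushf_strength[OF qms_qone X X qm_snd[OF qms_qone X] _ \<mu>, of "()"] pushf_id[OF \<mu>]
  by (simp add: qone_def pushf_def id_def)

lemma costrength_unit:
  assumes X: "qms S X" and \<mu>: "\<mu> \<in> pts (PP S X)"
  shows "pushf S X fst (costrength S X qone (\<mu>, ())) = \<mu>"
  using pushf_costrength[OF X qms_qone X qm_fst[OF X qms_qone] \<mu>, of "()"] pushf_id[OF \<mu>]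
  by (simp add: qone_def pushf_def id_def)

text \<open>In this and the next two laws two of the three coordinates are fixed; each side is the
  push-forward of the remaining measure along the map inserting them.\<close>

lemma strength_assoc:
  assumes X: "qms S X" and Y: "qms S Y" and Z: "qms S Z"
    and x: "x \<in> pts X" and y: "y \<in> pts Y" and \<kappa>: "\<kappa> \<in> pts (PP S Z)"
  shows "pushf S (X \<otimes>\<^sub>q Y \<otimes>\<^sub>q Z) assoc (strength S (X \<otimes>\<^sub>q Y) Z ((x, y), \<kappa>))
    = strength S X (Y \<otimes>\<^sub>q Z) (x, strength S Y Z (y, \<kappa>))"
proof -
  note XY = qms_qprod[OF X Y] note YZ = qms_qprod[OF Y Z] note XYZ = qms_qprod[OF X YZ]
  have "pushf S (X \<otimes>\<^sub>q Y \<otimes>\<^sub>q Z) assoc (strength S (X \<otimes>\<^sub>q Y) Z ((x, y), \<kappa>))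
      = distr \<kappa> (ind S (X \<otimes>\<^sub>q Y \<otimes>\<^sub>q Z)) (\<lambda>z. (x, y, z))"
    using x y by (simp add: pushf_strength[OF XY Z XYZ qm_assoc[OF X Y Z] _ \<kappa>])
  also have "\<dots> = pushf S (X \<otimes>\<^sub>q Y \<otimes>\<^sub>q Z) (Pair x) (strength S Y Z (y, \<kappa>))"
    by (simp add: pushf_strength[OF Y Z XYZ qm_Pair_left[OF X YZ x] y \<kappa>])
  also have "\<dots> = strength S X (Y \<otimes>\<^sub>q Z) (x, strength S Y Z (y, \<kappa>))"
    by (simp add: pushf_def strength_eq[OF X YZ x strength_pts[OF Y Z y \<kappa>]])
  finally show ?thesis .
qed

lemma costrength_assoc:
  assumes X: "qms S X" and Y: "qms S Y" and Z: "qms S Z"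
    and \<mu>: "\<mu> \<in> pts (PP S X)" and y: "y \<in> pts Y" and z: "z \<in> pts Z"
  shows "pushf S (X \<otimes>\<^sub>q Y \<otimes>\<^sub>q Z) assoc (costrength S (X \<otimes>\<^sub>q Y) Z (costrength S X Y (\<mu>, y), z))
    = costrength S X (Y \<otimes>\<^sub>q Z) (\<mu>, (y, z))"
proof -
  note XY = qms_qprod[OF X Y] note YZ = qms_qprod[OF Y Z] note XYZ = qms_qprod[OF X YZ]
  have "pushf S (X \<otimes>\<^sub>q Y \<otimes>\<^sub>q Z) assoc (costrength S (X \<otimes>\<^sub>q Y) Z (costrength S X Y (\<mu>, y), z))
      = pushf S (X \<otimes>\<^sub>q Y \<otimes>\<^sub>q Z) (\<lambda>p. assoc (p, z)) (costrength S X Y (\<mu>, y))"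
    unfolding pushf_costrength[OF XY Z XYZ qm_assoc[OF X Y Z] costrength_pts[OF X Y \<mu> y] z]
    by (simp add: pushf_def)
  also have "\<dots> = distr \<mu> (ind S (X \<otimes>\<^sub>q Y \<otimes>\<^sub>q Z)) (\<lambda>x. (x, y, z))"
    by (simp add: pushf_costrength[OF X Y XYZ qm_comp[OF qm_Pair_right[OF XY Z z] qm_assoc[OF X Y Z]] \<mu> y])
  also have "\<dots> = costrength S X (Y \<otimes>\<^sub>q Z) (\<mu>, (y, z))"
    using y z by (simp add: costrength_eq[OF X YZ \<mu>])
  finally show ?thesis .
qed

lemma strength_costrength_assoc:
  assumes X: "qms S X" and Y: "qms S Y" and Z: "qms S Z"
    and x: "x \<in> pts X" and \<nu>: "\<nu> \<in> pts (PP S Y)" and z: "z \<in> pts Z"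
  shows "pushf S (X \<otimes>\<^sub>q Y \<otimes>\<^sub>q Z) assoc (costrength S (X \<otimes>\<^sub>q Y) Z (strength S X Y (x, \<nu>), z))
    = strength S X (Y \<otimes>\<^sub>q Z) (x, costrength S Y Z (\<nu>, z))"
proof -
  note XY = qms_qprod[OF X Y] note YZ = qms_qprod[OF Y Z] note XYZ = qms_qprod[OF X YZ]
  have "pushf S (X \<otimes>\<^sub>q Y \<otimes>\<^sub>q Z) assoc (costrength S (X \<otimes>\<^sub>q Y) Z (strength S X Y (x, \<nu>), z))
      = pushf S (X \<otimes>\<^sub>q Y \<otimes>\<^sub>q Z) (\<lambda>p. assoc (p, z)) (strength S X Y (x, \<nu>))"
    unfolding pushf_costrength[OF XY Z XYZ qm_assoc[OF X Y Z] strength_pts[OF X Y x \<nu>] z]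
    by (simp add: pushf_def)
  also have "\<dots> = distr \<nu> (ind S (X \<otimes>\<^sub>q Y \<otimes>\<^sub>q Z)) (\<lambda>y. (x, y, z))"
    by (simp add: pushf_strength[OF X Y XYZ qm_comp[OF qm_Pair_right[OF XY Z z] qm_assoc[OF X Y Z]] x \<nu>])
  also have "\<dots> = pushf S (X \<otimes>\<^sub>q Y \<otimes>\<^sub>q Z) (Pair x) (costrength S Y Z (\<nu>, z))"
    by (simp add: pushf_costrength[OF Y Z XYZ qm_Pair_left[OF X YZ x] \<nu> z])
  also have "\<dots> = strength S X (Y \<otimes>\<^sub>q Z) (x, costrength S Y Z (\<nu>, z))"
    by (simp add: pushf_def strength_eq[OF X YZ x costrength_pts[OF Y Z \<nu> z]])
  finally show ?thesis .
qed

lemma strength_dirac: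
  assumes X: "qms S X" and Y: "qms S Y" and x: "x \<in> pts X" and y: "y \<in> pts Y"
  shows "strength S X Y (x, dirac S Y y) = dirac S (X \<otimes>\<^sub>q Y) (x, y)"
  using pushf_dirac[OF Y qms_qprod[OF X Y] qm_Pair_left[OF X Y x] y]
  by (simp add: strength_eq[OF X Y x dirac_pts[OF Y y]] pushf_def)

lemma costrength_dirac:
  assumes X: "qms S X" and Y: "qms S Y" and x: "x \<in> pts X" and y: "y \<in> pts Y"
  shows "costrength S X Y (dirac S X x, y) = dirac S (X \<otimes>\<^sub>q Y) (x, y)"
  using pushf_dirac[OF X qms_qprod[OF X Y] qm_Pair_right[OF X Y y] x]
  by (simp add: costrength_eq[OF X Y dirac_pts[OF X x] y] pushf_def)

text \<open>Push-forward along \<open>Pair x\<close> can be moved inside the \<open>bind\<close>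
  that represents \<open>mult\<close>.\<close>

lemma strength_mult:
  assumes iso: "qiso (qOmega S) (qOmega S \<otimes>\<^sub>q qOmega S)"
    and X: "qms S X" and Y: "qms S Y" and x: "x \<in> pts X" and \<pi>: "\<pi> \<in> pts (PP S (PP S Y))"
  shows "strength S X Y (x, mult S Y \<pi>)
    = mult S (X \<otimes>\<^sub>q Y) (pushf S (PP S (X \<otimes>\<^sub>q Y)) (strength S X Y) (strength S X (PP S Y) (x, \<pi>)))"
proof -
  note XY = qms_qprod[OF X Y] note PY = qms_PP[OF Y]
  have "strength S X Y (x, mult S Y \<pi>) = distr (\<pi> \<bind> (\<lambda>\<nu>. \<nu>)) (ind S (X \<otimes>\<^sub>q Y)) (Pair x)"
    by (simp add: strength_eq[OF X Y x qm_pts[OF qm_mult[OF iso Y] \<pi>]] flip: mult_eq_bind[OF Y \<pi>])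
  also have "\<dots> = \<pi> \<bind> (\<lambda>\<nu>. distr \<nu> (ind S (X \<otimes>\<^sub>q Y)) (Pair x))"
    by (rule distr_bind_qm[OF PY Y XY \<pi> qm_ident qm_Pair_left[OF X Y x]])
  also have "\<dots> = \<pi> \<bind> (\<lambda>\<nu>. strength S X Y (x, \<nu>))"
    by (rule bind_PP_cong[OF \<pi>]) (simp add: strength_eq[OF X Y x])
  also have "\<dots> = strength S X (PP S Y) (x, \<pi>) \<bind> strength S X Y"
    unfolding strength_eq[OF X PY x \<pi>]
    by (rule bind_distr_qm[OF PY qms_qprod[OF X PY] XY \<pi> qm_Pair_left[OF X PY x] qm_strength[OF X Y], symmetric])
  also have "\<dots> = mult S (X \<otimes>\<^sub>q Y) (pushf S (PP S (X \<otimes>\<^sub>q Y)) (strength S X Y) (strength S X (PP S Y) (x, \<pi>)))"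
    by (rule mult_pushf[OF qms_qprod[OF X PY] XY strength_pts[OF X PY x \<pi>] qm_strength[OF X Y], symmetric])
  finally show ?thesis .
qed

lemma costrength_mult:
  assumes iso: "qiso (qOmega S) (qOmega S \<otimes>\<^sub>q qOmega S)"
    and X: "qms S X" and Y: "qms S Y" and \<pi>: "\<pi> \<in> pts (PP S (PP S X))" and y: "y \<in> pts Y"
  shows "costrength S X Y (mult S X \<pi>, y)
    = mult S (X \<otimes>\<^sub>q Y) (pushf S (PP S (X \<otimes>\<^sub>q Y)) (costrength S X Y) (costrength S (PP S X) Y (\<pi>, y)))"
proof -
  note XY = qms_qprod[OF X Y] note PX = qms_PP[OF X]
  have "costrength S X Y (mult S X \<pi>, y) = distr (\<pi> \<bind> (\<lambda>\<mu>. \<mu>)) (ind S (X \<otimes>\<^sub>q Y)) (\<lambda>x. (x, y))"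
    by (simp add: costrength_eq[OF X Y qm_pts[OF qm_mult[OF iso X] \<pi>] y] flip: mult_eq_bind[OF X \<pi>])
  also have "\<dots> = \<pi> \<bind> (\<lambda>\<mu>. distr \<mu> (ind S (X \<otimes>\<^sub>q Y)) (\<lambda>x. (x, y)))"
    by (rule distr_bind_qm[OF PX X XY \<pi> qm_ident qm_Pair_right[OF X Y y]])
  also have "\<dots> = \<pi> \<bind> (\<lambda>\<mu>. costrength S X Y (\<mu>, y))"
    by (rule bind_PP_cong[OF \<pi>]) (simp add: costrength_eq[OF X Y _ y])
  also have "\<dots> = costrength S (PP S X) Y (\<pi>, y) \<bind> costrength S X Y"
    unfolding costrength_eq[OF PX Y \<pi> y]
    by (rule bind_distr_qm[OF PX qms_qprod[OF PX Y] XY \<pi> qm_Pair_right[OF PX Y y] qm_costrength[OF X Y], symmetric])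
  also have "\<dots> = mult S (X \<otimes>\<^sub>q Y) (pushf S (PP S (X \<otimes>\<^sub>q Y)) (costrength S X Y) (costrength S (PP S X) Y (\<pi>, y)))"
    by (rule mult_pushf[OF qms_qprod[OF PX Y] XY costrength_pts[OF PX Y \<pi> y] qm_costrength[OF X Y], symmetric])
  finally show ?thesis .
qed

lemma costrength_swap:
  assumes X: "qms S X" and Y: "qms S Y" and \<mu>: "\<mu> \<in> pts (PP S X)" and y: "y \<in> pts Y"
  shows "costrength S X Y (\<mu>, y) = pushf S (X \<otimes>\<^sub>q Y) prod.swap (strength S Y X (y, \<mu>))"
  by (simp add: pushf_strength[OF Y X qms_qprod[OF X Y] qm_swap[OF Y X] y \<mu>] costrength_eq[OF X Y \<mu> y])

section \<open>The double strengths\<close>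

text \<open>The strength carries \<open>\<mu>\<close> along as a point while \<open>y\<close> is
  drawn from \<open>\<nu>\<close>; the costrength then draws \<open>x\<close> from
  \<open>\<mu>\<close>. So \<open>\<nu>\<close> is outermost, as in \<open>tensor\<close>.\<close>

lemma dstrength_eq_tensor:
  assumes X: "qms S X" and Y: "qms S Y" and \<mu>: "\<mu> \<in> pts (PP S X)" and \<nu>: "\<nu> \<in> pts (PP S Y)"
  shows "dstrength S X Y (\<mu>, \<nu>) = tensor S X Y \<mu> \<nu>"
proof -
  note XY = qms_qprod[OF X Y] note PX = qms_PP[OF X]
  have "dstrength S X Y (\<mu>, \<nu>) = strength S (PP S X) Y (\<mu>, \<nu>) \<bind> costrength S X Y"
    unfolding dstrength_def comp_def
    by (rule mult_pushf[OF qms_qprod[OF PX Y] XY strength_pts[OF PX Y \<mu> \<nu>] qm_costrength[OF X Y]])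
  also have "\<dots> = \<nu> \<bind> (\<lambda>y. costrength S X Y (\<mu>, y))"
    unfolding strength_eq[OF PX Y \<mu> \<nu>]
    by (rule bind_distr_qm[OF Y qms_qprod[OF PX Y] XY \<nu> qm_Pair_left[OF PX Y \<mu>] qm_costrength[OF X Y]])
  also have "\<dots> = tensor S X Y \<mu> \<nu>"
    unfolding tensor_eq_bind[OF X Y \<mu> \<nu>] by (rule bind_PP_cong[OF \<nu>]) (rule costrength_eq[OF X Y \<mu>])
  finally show ?thesis .
qed

text \<open>Now \<open>\<nu>\<close> is carried along as a point while \<open>x\<close> is drawn,
  which puts \<open>\<mu>\<close> outermost.\<close>

lemma dstrength'_eq_bind:
  assumes X: "qms S X" and Y: "qms S Y" and \<mu>: "\<mu> \<in> pts (PP S X)" and \<nu>: "\<nu> \<in> pts (PP S Y)"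
  shows "dstrength' S X Y (\<mu>, \<nu>) = \<mu> \<bind> (\<lambda>x. strength S X Y (x, \<nu>))"
proof -
  note XY = qms_qprod[OF X Y] note PY = qms_PP[OF Y]
  have "dstrength' S X Y (\<mu>, \<nu>) = costrength S X (PP S Y) (\<mu>, \<nu>) \<bind> strength S X Y"
    unfolding dstrength'_def comp_def
    by (rule mult_pushf[OF qms_qprod[OF X PY] XY costrength_pts[OF X PY \<mu> \<nu>] qm_strength[OF X Y]])
  also have "\<dots> = \<mu> \<bind> (\<lambda>x. strength S X Y (x, \<nu>))"
    unfolding costrength_eq[OF X PY \<mu> \<nu>]
    by (rule bind_distr_qm[OF X qms_qprod[OF X PY] XY \<mu> qm_Pair_right[OF X PY \<nu>] qm_strength[OF X Y]])
  finally show ?thesis .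
qed

lemma qm_dstrength:
  assumes X: "qms S X" and Y: "qms S Y"
  shows "dstrength S X Y \<in> qm (PP S X \<otimes>\<^sub>q PP S Y) (PP S (X \<otimes>\<^sub>q Y))"
proof (rule qmI[OF qms_qprod[OF qms_PP[OF X] qms_PP[OF Y]] qms_PP[OF qms_qprod[OF X Y]]])
  fix \<gamma> assume \<gamma>: "\<gamma> \<in> rvs (PP S X \<otimes>\<^sub>q PP S Y)"
  \<comment> \<open>The agreement with \<open>tensor\<close> holds only on the carrier, so it is
    used at the values of a random variable and not as an equation of functions.\<close>
  have "dstrength S X Y (\<gamma> w) = (case \<gamma> w of (\<mu>, \<nu>) \<Rightarrow> tensor S X Y \<mu> \<nu>)" for w
    using qms_rv_pts[OF qms_qprod[OF qms_PP[OF X] qms_PP[OF Y]] \<gamma>, of w] dstrength_eq_tensor[OF X Y]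
    by (cases "\<gamma> w") simp
  then show "(\<lambda>w. dstrength S X Y (\<gamma> w)) \<in> rvs (PP S (X \<otimes>\<^sub>q Y))"
    using qm_rv[OF qm_tensor[OF X Y] \<gamma>] by simp
qed

lemma tensor_natural:
  assumes X: "qms S X" and Y: "qms S Y" and Z: "qms S Z" and W: "qms S W"
    and f: "f \<in> qm X Z" and g: "g \<in> qm Y W" and \<mu>: "\<mu> \<in> pts (PP S X)" and \<nu>: "\<nu> \<in> pts (PP S Y)"
  shows "pushf S (Z \<otimes>\<^sub>q W) (map_prod f g) (tensor S X Y \<mu> \<nu>) = tensor S Z W (pushf S Z f \<mu>) (pushf S W g \<nu>)"
proof -
  note ZW = qms_qprod[OF Z W]
  note f\<mu> = qm_pts[OF qm_pushf[OF X Z f] \<mu>] and g\<nu> = qm_pts[OF qm_pushf[OF Y W g] \<nu>]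
  have "tensor S Z W (pushf S Z f \<mu>) (pushf S W g \<nu>)
      = distr \<nu> (ind S W) g \<bind> (\<lambda>w. distr (pushf S Z f \<mu>) (ind S (Z \<otimes>\<^sub>q W)) (\<lambda>z. (z, w)))"
    unfolding tensor_eq_bind[OF Z W f\<mu> g\<nu>] by (simp add: pushf_def)
  also have "\<dots> = \<nu> \<bind> (\<lambda>y. distr (pushf S Z f \<mu>) (ind S (Z \<otimes>\<^sub>q W)) (\<lambda>z. (z, g y)))"
    by (rule bind_distr_qm[OF Y W ZW \<nu> g qm_section_left[OF Z W f\<mu>]])
  also have "\<dots> = \<nu> \<bind> (\<lambda>y. distr \<mu> (ind S (Z \<otimes>\<^sub>q W)) (\<lambda>x. map_prod f g (x, y)))"
    unfolding pushf_def
    by (rule bind_PP_cong[OF \<nu>])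
      (simp add: distr_distr_qm[OF X Z ZW \<mu> f qm_Pair_right[OF Z W qm_pts[OF g]]])
  also have "\<dots> = pushf S (Z \<otimes>\<^sub>q W) (map_prod f g) (tensor S X Y \<mu> \<nu>)"
    by (rule pushf_tensor[OF X Y ZW \<mu> \<nu> qm_map_prod[OF X Y Z W f g], symmetric])
  finally show ?thesis ..
qed

text \<open>Both bracketings integrate over \<open>\<kappa>\<close> outermost, then
  \<open>\<nu>\<close>, then \<open>\<mu>\<close>.\<close>

lemma tensor_assoc:
  assumes X: "qms S X" and Y: "qms S Y" and Z: "qms S Z"
    and \<mu>: "\<mu> \<in> pts (PP S X)" and \<nu>: "\<nu> \<in> pts (PP S Y)" and \<kappa>: "\<kappa> \<in> pts (PP S Z)"
  shows "pushf S (X \<otimes>\<^sub>q Y \<otimes>\<^sub>q Z) assoc (tensor S (X \<otimes>\<^sub>q Y) Z (tensor S X Y \<mu> \<nu>) \<kappa>)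
    = tensor S X (Y \<otimes>\<^sub>q Z) \<mu> (tensor S Y Z \<nu> \<kappa>)"
proof -
  note XY = qms_qprod[OF X Y] note YZ = qms_qprod[OF Y Z] note XYZ = qms_qprod[OF X YZ]
  have "pushf S (X \<otimes>\<^sub>q Y \<otimes>\<^sub>q Z) assoc (tensor S (X \<otimes>\<^sub>q Y) Z (tensor S X Y \<mu> \<nu>) \<kappa>)
      = \<kappa> \<bind> (\<lambda>z. pushf S (X \<otimes>\<^sub>q Y \<otimes>\<^sub>q Z) (\<lambda>p. assoc (p, z)) (tensor S X Y \<mu> \<nu>))"
    unfolding pushf_tensor[OF XY Z XYZ tensor_pts[OF X Y \<mu> \<nu>] \<kappa> qm_assoc[OF X Y Z]] by (simp add: pushf_def)
  also have "\<dots> = \<kappa> \<bind> (\<lambda>z. \<nu> \<bind> (\<lambda>y. distr \<mu> (ind S (X \<otimes>\<^sub>q Y \<otimes>\<^sub>q Z)) (\<lambda>x. (x, y, z))))"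
    by (rule bind_PP_cong[OF \<kappa>])
      (simp add: pushf_tensor[OF X Y XYZ \<mu> \<nu> qm_comp[OF qm_Pair_right[OF XY Z] qm_assoc[OF X Y Z]]])
  also have "\<dots> = tensor S Y Z \<nu> \<kappa> \<bind> (\<lambda>p. distr \<mu> (ind S (X \<otimes>\<^sub>q Y \<otimes>\<^sub>q Z)) (\<lambda>x. (x, p)))"
    by (rule tensor_bind[OF Y Z XYZ \<nu> \<kappa> qm_section_left[OF X YZ \<mu>], symmetric])
  also have "\<dots> = tensor S X (Y \<otimes>\<^sub>q Z) \<mu> (tensor S Y Z \<nu> \<kappa>)"
    by (rule tensor_eq_bind[OF X YZ \<mu> tensor_pts[OF Y Z \<nu> \<kappa>], symmetric])
  finally show ?thesis .
qed

section \<open>Consequences of the Fubini property\<close>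

text \<open>The Fubini property speaks of \<Omega> \<times> \<Omega> only. Representing
  \<open>\<mu>\<close> and \<open>\<nu>\<close> as push-forwards turns both masses of a set
  \<open>D\<close> into iterated integrals over one set there.\<close>

lemma tensor_flip:
  assumes fubini: "fubini_property S"
    and X: "qms S X" and Y: "qms S Y" and \<mu>: "\<mu> \<in> pts (PP S X)" and \<nu>: "\<nu> \<in> pts (PP S Y)"
  shows "tensor S X Y \<mu> \<nu> = \<mu> \<bind> (\<lambda>x. strength S X Y (x, \<nu>))" (is "_ = ?M")
proof (rule measure_eqI)
  note XY = qms_qprod[OF X Y]
  have strength: "(\<lambda>x. strength S X Y (x, \<nu>)) \<in> qm X (PP S (X \<otimes>\<^sub>q Y))"
    by (rule qm_comp[OF qm_Pair_right[OF X qms_PP[OF Y] \<nu>] qm_strength[OF X Y]])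
  have ne: "space \<mu> \<noteq> {}" "space \<nu> \<noteq> {}"
    using PP_not_empty X Y \<mu> \<nu> by blast+
  have sets: "sets (tensor S X Y \<mu> \<nu>) = sets (ind S (X \<otimes>\<^sub>q Y))"
    by (rule sets_PP[OF tensor_pts[OF X Y \<mu> \<nu>]])
  show "sets (tensor S X Y \<mu> \<nu>) = sets ?M"
    unfolding sets
    by (rule sets_bind[OF _ ne(1), symmetric])
      (simp add: space_PP[OF \<mu>] sets_PP[OF strength_pts[OF X Y _ \<nu>]])
  fix D assume "D \<in> sets (tensor S X Y \<mu> \<nu>)"
  then have D: "D \<in> sets (ind S (X \<otimes>\<^sub>q Y))"
    by (simp add: sets)
  obtain P \<alpha> where P: "P \<in> probs S" and \<alpha>: "\<alpha> \<in> rvs X" and \<mu>_eq: "\<mu> = distr P (ind S X) \<alpha>"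
    using \<mu> by (rule PP_ptE)
  obtain Q \<beta> where Q: "Q \<in> probs S" and \<beta>: "\<beta> \<in> rvs Y" and \<nu>_eq: "\<nu> = distr Q (ind S Y) \<beta>"
    using \<nu> by (rule PP_ptE)
  \<comment> \<open>The pullback of \<open>D\<close> along \<open>\<alpha>\<close> and
    \<open>\<beta>\<close>. It lies in the induced \<sigma>-algebra of \<Omega> \<times> \<Omega>,
    which is what the Fubini property asks for.\<close>
  define E where "E = {(v, w). (\<alpha> v, \<beta> w) \<in> D}"
  have "(\<lambda>w v. (\<alpha> v, \<beta> w)) \<in> rvs2 S (X \<otimes>\<^sub>q Y)"
    using qms_rv_comp[OF X \<alpha>] qms_rv_comp[OF Y \<beta>] by (simp add: rvs2_iff XY rvs_qprod_iff)
  from rvs2_fibre_sets[OF XY this D] have E: "E \<in> ind_sets S (qOmega S \<otimes>\<^sub>q qOmega S)"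
    by (simp add: E_def)
  have left: "emeasure (tensor S X Y \<mu> \<nu>) D = (\<integral>\<^sup>+ w. emeasure P {v. (v, w) \<in> E} \<partial>Q)"
  proof -
    let ?K = "\<lambda>y. distr \<mu> (ind S (X \<otimes>\<^sub>q Y)) (\<lambda>x. (x, y))"
    note kernel = measurable_kernel[OF Y XY qm_section_left[OF X Y \<mu>]]
    have "emeasure (tensor S X Y \<mu> \<nu>) D = (\<integral>\<^sup>+ y. emeasure (?K y) D \<partial>\<nu>)"
      unfolding tensor_eq_bind[OF X Y \<mu> \<nu>]
      by (rule emeasure_bind[OF ne(2) measurable_PP[OF \<nu> kernel] D])
    also have "\<dots> = (\<integral>\<^sup>+ w. emeasure (?K (\<beta> w)) D \<partial>Q)"
      unfolding \<nu>_eq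
      by (rule nn_integral_distr[OF measurable_probs_rv[OF Q Y \<beta>]])
        (simp add: measurable_compose[OF kernel measurable_emeasure_subprob_algebra[OF D]])
    also have "\<dots> = (\<integral>\<^sup>+ w. emeasure P {v. (v, w) \<in> E} \<partial>Q)"
    proof (rule nn_integral_cong)
      fix w
      note meas = measurable_qm[OF X XY qm_Pair_right[OF X Y qms_rv_pts[OF Y \<beta>]]]
      have "emeasure (?K (\<beta> w)) D = emeasure (distr P (ind S (X \<otimes>\<^sub>q Y)) (\<lambda>v. (\<alpha> v, \<beta> w))) D"
        by (simp add: \<mu>_eq distr_distr[OF meas measurable_probs_rv[OF P X \<alpha>]] comp_def)
      also have "\<dots> = emeasure P {v. (v, w) \<in> E}"
        using emeasure_distr[OF measurable_compose[OF measurable_probs_rv[OF P X \<alpha>] meas] D]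
        by (simp add: E_def vimage_def space_probs[OF P])
      finally show "emeasure (?K (\<beta> w)) D = emeasure P {v. (v, w) \<in> E}" .
    qed
    finally show ?thesis .
  qed
  have right: "emeasure ?M D = (\<integral>\<^sup>+ v. emeasure Q {w. (v, w) \<in> E} \<partial>P)"
  proof -
    note kernel = measurable_kernel[OF X XY strength]
    have "emeasure ?M D = (\<integral>\<^sup>+ x. emeasure (strength S X Y (x, \<nu>)) D \<partial>\<mu>)"
      by (rule emeasure_bind[OF ne(1) measurable_PP[OF \<mu> kernel] D])
    also have "\<dots> = (\<integral>\<^sup>+ v. emeasure (strength S X Y (\<alpha> v, \<nu>)) D \<partial>P)"
      unfolding \<mu>_eq
      by (rule nn_integral_distr[OF measurable_probs_rv[OF P X \<alpha>]])
        (simp add: measurable_compose[OF kernel measurable_emeasure_subprob_algebra[OF D]])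
    also have "\<dots> = (\<integral>\<^sup>+ v. emeasure Q {w. (v, w) \<in> E} \<partial>P)"
    proof (rule nn_integral_cong)
      fix v
      note x = qms_rv_pts[OF X \<alpha>] note meas = measurable_qm[OF Y XY qm_Pair_left[OF X Y x]]
      have "emeasure (strength S X Y (\<alpha> v, \<nu>)) D = emeasure (distr Q (ind S (X \<otimes>\<^sub>q Y)) (\<lambda>w. (\<alpha> v, \<beta> w))) D"
        unfolding strength_eq[OF X Y x \<nu>]
        by (simp add: \<nu>_eq distr_distr[OF meas measurable_probs_rv[OF Q Y \<beta>]] comp_def)
      also have "\<dots> = emeasure Q {w. (v, w) \<in> E}"
        using emeasure_distr[OF measurable_compose[OF measurable_probs_rv[OF Q Y \<beta>] meas] D]
        by (simp add: E_def vimage_def space_probs[OF Q])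
      finally show "emeasure (strength S X Y (\<alpha> v, \<nu>)) D = emeasure Q {w. (v, w) \<in> E}" .
    qed
    finally show ?thesis .
  qed
  show "emeasure (tensor S X Y \<mu> \<nu>) D = emeasure ?M D"
    using fubini P Q E unfolding left right fubini_property_def by simp
qed

text \<open>Exchange of integrals for arbitrary kernels: integrating \<open>h\<close> against the
  two forms of the product in \<open>tensor_flip\<close> gives the two orders.\<close>

lemma bind_commute:
  assumes fubini: "fubini_property S"
    and X: "qms S X" and Y: "qms S Y" and Z: "qms S Z"
    and \<mu>: "\<mu> \<in> pts (PP S X)" and \<nu>: "\<nu> \<in> pts (PP S Y)" and h: "h \<in> qm (X \<otimes>\<^sub>q Y) (PP S Z)"
  shows "\<nu> \<bind> (\<lambda>y. \<mu> \<bind> (\<lambda>x. h (x, y))) = \<mu> \<bind> (\<lambda>x. \<nu> \<bind> (\<lambda>y. h (x, y)))"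
proof -
  note XY = qms_qprod[OF X Y]
  have "\<nu> \<bind> (\<lambda>y. \<mu> \<bind> (\<lambda>x. h (x, y))) = (\<mu> \<bind> (\<lambda>x. strength S X Y (x, \<nu>))) \<bind> h"
    by (simp add: tensor_bind[OF X Y Z \<mu> \<nu> h, symmetric] tensor_flip[OF fubini X Y \<mu> \<nu>])
  also have "\<dots> = \<mu> \<bind> (\<lambda>x. strength S X Y (x, \<nu>) \<bind> h)"
    by (rule bind_assoc_qm[OF X XY Z \<mu> qm_comp[OF qm_Pair_right[OF X qms_PP[OF Y] \<nu>] qm_strength[OF X Y]] h])
  also have "\<dots> = \<mu> \<bind> (\<lambda>x. \<nu> \<bind> (\<lambda>y. h (x, y)))"
    by (rule bind_PP_cong[OF \<mu>])
      (simp add: strength_eq[OF X Y _ \<nu>] bind_distr_qm[OF Y XY Z \<nu> qm_Pair_left[OF X Y] h])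
  finally show ?thesis .
qed

text \<open>Pushing forward leaves \<open>\<nu>\<close> outermost, whereas
  \<open>tensor S Y X \<nu> \<mu>\<close> has \<open>\<mu>\<close> outermost; the flip is applied to
  the latter.\<close>

lemma tensor_swap:
  assumes fubini: "fubini_property S"
    and X: "qms S X" and Y: "qms S Y" and \<mu>: "\<mu> \<in> pts (PP S X)" and \<nu>: "\<nu> \<in> pts (PP S Y)"
  shows "pushf S (Y \<otimes>\<^sub>q X) prod.swap (tensor S X Y \<mu> \<nu>) = tensor S Y X \<nu> \<mu>"
  unfolding pushf_tensor[OF X Y qms_qprod[OF Y X] \<mu> \<nu> qm_swap[OF X Y]] tensor_flip[OF fubini Y X \<nu> \<mu>]
  by (rule bind_PP_cong[OF \<nu>]) (simp add: strength_eq[OF Y X _ \<mu>])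

text \<open>On the left the integrals run, from outside in, over \<open>\<sigma>\<close>,
  \<open>\<nu>\<close>, \<open>\<pi>\<close>, \<open>\<mu>\<close>; on the right over
  \<open>\<sigma>\<close>, \<open>\<pi>\<close>, \<open>\<nu>\<close>, \<open>\<mu>\<close>. The
  middle pair has to be exchanged, which is \<open>bind_commute\<close> with a measure on
  \<open>PP S X\<close> as one factor.\<close>

lemma tensor_mult:
  assumes fubini: "fubini_property S" and iso: "qiso (qOmega S) (qOmega S \<otimes>\<^sub>q qOmega S)"
    and X: "qms S X" and Y: "qms S Y" and \<pi>: "\<pi> \<in> pts (PP S (PP S X))" and \<sigma>: "\<sigma> \<in> pts (PP S (PP S Y))"
  shows "tensor S X Y (mult S X \<pi>) (mult S Y \<sigma>)
    = mult S (X \<otimes>\<^sub>q Y) (pushf S (PP S (X \<otimes>\<^sub>q Y)) (dstrength S X Y) (tensor S (PP S X) (PP S Y) \<pi> \<sigma>))"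
proof -
  note XY = qms_qprod[OF X Y] note PX = qms_PP[OF X] note PY = qms_PP[OF Y]
  note m\<pi> = qm_pts[OF qm_mult[OF iso X] \<pi>] and m\<sigma> = qm_pts[OF qm_mult[OF iso Y] \<sigma>]
  have "tensor S X Y (mult S X \<pi>) (mult S Y \<sigma>)
      = (\<sigma> \<bind> (\<lambda>\<nu>. \<nu>)) \<bind> (\<lambda>y. distr (mult S X \<pi>) (ind S (X \<otimes>\<^sub>q Y)) (\<lambda>x. (x, y)))"
    unfolding tensor_eq_bind[OF X Y m\<pi> m\<sigma>] by (simp add: mult_eq_bind[OF Y \<sigma>])
  also have "\<dots> = \<sigma> \<bind> (\<lambda>\<nu>. \<nu> \<bind> (\<lambda>y. distr (mult S X \<pi>) (ind S (X \<otimes>\<^sub>q Y)) (\<lambda>x. (x, y))))"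
    by (rule bind_assoc_qm[OF PY Y XY \<sigma> qm_ident qm_section_left[OF X Y m\<pi>]])
  also have "\<dots> = \<sigma> \<bind> (\<lambda>\<nu>. \<pi> \<bind> (\<lambda>\<mu>. dstrength S X Y (\<mu>, \<nu>)))"
  proof (rule bind_PP_cong[OF \<sigma>])
    fix \<nu> assume \<nu>: "\<nu> \<in> pts (PP S Y)"
    have "\<nu> \<bind> (\<lambda>y. distr (mult S X \<pi>) (ind S (X \<otimes>\<^sub>q Y)) (\<lambda>x. (x, y)))
        = \<nu> \<bind> (\<lambda>y. \<pi> \<bind> (\<lambda>\<mu>. costrength S X Y (\<mu>, y)))"
    proof (rule bind_PP_cong[OF \<nu>])
      fix y assume y: "y \<in> pts Y"
      have "distr (mult S X \<pi>) (ind S (X \<otimes>\<^sub>q Y)) (\<lambda>x. (x, y))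
          = \<pi> \<bind> (\<lambda>\<mu>. distr \<mu> (ind S (X \<otimes>\<^sub>q Y)) (\<lambda>x. (x, y)))"
        unfolding mult_eq_bind[OF X \<pi>] by (rule distr_bind_qm[OF PX X XY \<pi> qm_ident qm_Pair_right[OF X Y y]])
      also have "\<dots> = \<pi> \<bind> (\<lambda>\<mu>. costrength S X Y (\<mu>, y))"
        by (rule bind_PP_cong[OF \<pi>]) (simp add: costrength_eq[OF X Y _ y])
      finally show "distr (mult S X \<pi>) (ind S (X \<otimes>\<^sub>q Y)) (\<lambda>x. (x, y)) = \<pi> \<bind> (\<lambda>\<mu>. costrength S X Y (\<mu>, y))" .
    qed
    also have "\<dots> = \<pi> \<bind> (\<lambda>\<mu>. \<nu> \<bind> (\<lambda>y. costrength S X Y (\<mu>, y)))"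
      by (rule bind_commute[OF fubini PX Y XY \<pi> \<nu> qm_costrength[OF X Y]])
    also have "\<dots> = \<pi> \<bind> (\<lambda>\<mu>. dstrength S X Y (\<mu>, \<nu>))"
    proof (rule bind_PP_cong[OF \<pi>])
      fix \<mu> assume \<mu>: "\<mu> \<in> pts (PP S X)"
      show "\<nu> \<bind> (\<lambda>y. costrength S X Y (\<mu>, y)) = dstrength S X Y (\<mu>, \<nu>)"
        unfolding dstrength_eq_tensor[OF X Y \<mu> \<nu>] tensor_eq_bind[OF X Y \<mu> \<nu>]
        by (rule bind_PP_cong[OF \<nu>]) (rule costrength_eq[OF X Y \<mu>])
    qed
    finally show "\<nu> \<bind> (\<lambda>y. distr (mult S X \<pi>) (ind S (X \<otimes>\<^sub>q Y)) (\<lambda>x. (x, y)))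
        = \<pi> \<bind> (\<lambda>\<mu>. dstrength S X Y (\<mu>, \<nu>))" .
  qed
  also have "\<dots> = tensor S (PP S X) (PP S Y) \<pi> \<sigma> \<bind> dstrength S X Y"
    by (rule tensor_bind[OF PX PY XY \<pi> \<sigma> qm_dstrength[OF X Y], symmetric])
  also have "\<dots> = mult S (X \<otimes>\<^sub>q Y) (pushf S (PP S (X \<otimes>\<^sub>q Y)) (dstrength S X Y) (tensor S (PP S X) (PP S Y) \<pi> \<sigma>))"
    by (rule mult_pushf[OF qms_qprod[OF PX PY] XY tensor_pts[OF PX PY \<pi> \<sigma>] qm_dstrength[OF X Y], symmetric])
  finally show ?thesis .
qed

section \<open>The laws assembled\<close>

lemma monad_on_QMS:
  assumes "qiso (qOmega S) (qOmega S \<otimes>\<^sub>q qOmega S)"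
  shows "monad_on_QMS S TYPE('x) TYPE('y) TYPE('z)"
  unfolding monad_on_QMS_def
  by (intro conjI allI impI ballI)
    (blast intro: qms_PP qm_pushf pushf_id pushf_comp qm_dirac qm_mult[OF assms] pushf_dirac pushf_mult
      mult_dirac mult_pushf_dirac mult_mult[OF assms])+

lemma strong_monad:
  assumes "qiso (qOmega S) (qOmega S \<otimes>\<^sub>q qOmega S)"
  shows "strong_monad S TYPE('x) TYPE('y) TYPE('z) TYPE('w)"
  unfolding strong_monad_def
  by (intro conjI allI impI ballI qm_strength qm_costrength strength_natural costrength_natural
      strength_unit costrength_unit strength_assoc costrength_assoc strength_costrength_assoc
      strength_dirac costrength_dirac strength_mult[OF assms] costrength_mult[OF assms] costrength_swap)

lemma commutative_monad:
  assumes "fubini_property S"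
  shows "commutative_monad S TYPE('x) TYPE('y)"
  unfolding commutative_monad_def
  by (auto simp: dstrength_eq_tensor dstrength'_eq_bind tensor_flip[OF assms])

lemma symmetric_monoidal_monad:
  assumes "fubini_property S" "qiso (qOmega S) (qOmega S \<otimes>\<^sub>q qOmega S)"
  shows "symmetric_monoidal_monad S TYPE('x) TYPE('y) TYPE('z) TYPE('w)"
proof -
  have unit: "dirac S qone () \<in> pts (PP S (qone :: ('o, unit) qspace))"
    by (rule dirac_pts[OF qms_qone]) (simp add: qone_def)
  \<comment> \<open>With \<open>dstrength\<close> replaced by \<open>tensor\<close>, a Dirac factor
    makes it a strength or costrength by definition, so the monoidal unit laws reduce to
    theirs.\<close>
  have "tensor S qone X (dirac S qone ()) \<mu> = strength S qone X ((), \<mu>)"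
    and "tensor S X qone \<mu> (dirac S qone ()) = costrength S X qone (\<mu>, ())" for X :: "('o, 'x) qspace" and \<mu>
    by (simp_all add: strength_def costrength_def)
  moreover have "tensor S X Y (dirac S X x) (dirac S Y y) = dirac S (X \<otimes>\<^sub>q Y) (x, y)"
    if "qms S X" "qms S Y" "x \<in> pts X" "y \<in> pts Y" for X :: "('o, 'x) qspace" and Y :: "('o, 'y) qspace" and x y
    using strength_dirac[OF that] by (simp add: strength_def)
  ultimately show ?thesis
    unfolding symmetric_monoidal_monad_def
    by (simp add: qm_dirac qms_qone qm_dstrength dstrength_eq_tensor unit qms_qprod qms_PP
        tensor_pts qm_pts[OF qm_pushf] qm_pts[OF qm_mult[OF assms(2)]] dirac_pts tensor_natural tensor_assoc
        strength_unit costrength_unit tensor_swap[OF assms(1)] tensor_mult[OF assms] mult_pushf_dirac)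
qed

end

theorem theorem5p23:
  fixes S :: "'o sample"
  assumes "sample_space S"
    and "product_compatible S"
    and "qiso (qOmega S) (qOmega S \<otimes>\<^sub>q qOmega S)"
  shows "monad_on_QMS S TYPE('x) TYPE('y) TYPE('z) \<and>
         affine_monad S \<and>
         strong_monad S TYPE('x) TYPE('y) TYPE('z) TYPE('w) \<and>
         (fubini_property S \<longrightarrow>
            commutative_monad S TYPE('x) TYPE('y) \<and>
            symmetric_monoidal_monad S TYPE('x) TYPE('y) TYPE('z) TYPE('w))"
proof -
  interpret compatible_sample S
    using assms(1,2) by unfold_locales
  show ?thesis
    using assms(3) by (simp add: monad_on_QMS affine strong_monad commutative_monad symmetric_monoidal_monad)
qed

end
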